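(* Let $K$ be an algebraically closed field of characteristic zero and let $d\ge 1$ be an integer. For each integer $k$ with $0\le k\le \left[\frac d2\right]$ we have $$\overline{S_{d,k+1}}\setminus\overline{S_{d,k}} = S_{d,k+1}\cup S_{d,d-k+1},$$ where $\overline{S_{d,0}}=\emptyset$. Moreover, for every nonzero $q\in\overline{S_{d,k+1}}\setminus\overline{S_{d,k}}$ we have $\operatorname{rank} q=k+1$ if and only if $[q]$ lies on a secant $k$-plane to $X$; otherwise $\operatorname{rank} q=d-k+1$.
   Context: $S_d$ is the $K$-vector space of homogeneous polynomials of degree $d$ in two variables $x,y$ (binary forms), with $S_1$ the linear forms. The rank of $q\in S_d$ is the least integer $r\ge 1$ such that $q=L_1^d+\dots+L_r^d$ with $L_i\in S_1$ (the $L_i$ are allowed to be zero, so the zero form has rank $1$). $S_{d,r}=\{q\in S_d:\operatorname{rank} q=r\}$. The bar denotes Zariski closure in the affine space $S_d$. $[\cdot]$ is the integer part when applied to a number, and $[q]$ is the class of a nonzero $q$ in $\mathbb{P}(S_d)$. $X\subset\mathbb{P}(S_d)$ is the Veronese curve, the image of $\mathbb{P}(S_1)\to\mathbb{P}(S_d)$, $[L]\mapsto[L^d]$. A secant $k$-plane to $X$ is a $k$-dimensional projective linear subspace spanned by $k+1$ points of $X$. *)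

theory Defs
  imports "HOL-Computational_Algebra.Fundamental_Theorem_Algebra" "HOL.Hull"
begin

text \<open>
  A polynomial in \<open>K[x,y]\<close> is an element of \<open>K[x][y]\<close>: \<open>coeff (coeff q j) i\<close> is the
  coefficient of \<open>x\<^sup>i y\<^sup>j\<close> in \<open>q\<close>.
\<close>

definition forms :: "nat \<Rightarrow> 'a::field poly poly set" where
  "forms d = {q. \<forall>i j. coeff (coeff q j) i \<noteq> 0 \<longrightarrow> i + j = d}"

definition form_rank :: "nat \<Rightarrow> 'a::field poly poly \<Rightarrow> nat" where
  "form_rank d q =
     (LEAST r. 1 \<le> r \<and> (\<exists>L::nat \<Rightarrow> 'a poly poly. (\<forall>i<r. L i \<in> forms 1) \<and> q = (\<Sum>i<r. L i ^ d)))"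

definition rank_locus :: "nat \<Rightarrow> nat \<Rightarrow> 'a::field poly poly set" where
  "rank_locus d r = {q \<in> forms d. form_rank d q = r}"


text \<open>
  The polynomial functions on the affine space \<open>S\<^sub>d\<close>: the algebra of functions generated by
  the constants and the \<open>d + 1\<close> coordinates, which are the coefficients of \<open>x\<^sup>i y\<^sup>j\<close>, \<open>i + j = d\<close>.
\<close>

inductive_set form_polyfuns :: "nat \<Rightarrow> ('a::field poly poly \<Rightarrow> 'a) set" for d :: nat where
  const: "(\<lambda>q. c) \<in> form_polyfuns d"
| coord: "i + j = d \<Longrightarrow> (\<lambda>q. coeff (coeff q j) i) \<in> form_polyfuns d"
| add: "f \<in> form_polyfuns d \<Longrightarrow> g \<in> form_polyfuns d \<Longrightarrow> (\<lambda>q. f q + g q) \<in> form_polyfuns d"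
| mult: "f \<in> form_polyfuns d \<Longrightarrow> g \<in> form_polyfuns d \<Longrightarrow> (\<lambda>q. f q * g q) \<in> form_polyfuns d"

definition zariski_closed :: "nat \<Rightarrow> 'a::field poly poly set \<Rightarrow> bool" where
  "zariski_closed d Z \<longleftrightarrow> (\<exists>F \<subseteq> form_polyfuns d. Z = {q \<in> forms d. \<forall>f\<in>F. f q = 0})"

definition zariski_closure :: "nat \<Rightarrow> 'a::field poly poly set \<Rightarrow> 'a poly poly set" where
  "zariski_closure d A = zariski_closed d hull A"


definition scale_form :: "'a::field \<Rightarrow> 'a poly poly \<Rightarrow> 'a poly poly" where
  "scale_form c q = smult [:c:] q"

interpretation form: vector_space scale_form
  by unfold_locales
     (simp_all add: scale_form_def smult_add_right mult.commute flip: smult_add_left one_pCons)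

definition proj_point :: "'a::field poly poly \<Rightarrow> 'a poly poly set" where
  "proj_point q = {scale_form c q | c. c \<noteq> 0}"

definition proj_space :: "'a::field poly poly set \<Rightarrow> 'a poly poly set set" where
  "proj_space V = proj_point ` (V - {0})"

definition veronese_curve :: "nat \<Rightarrow> 'a::field poly poly set set" where
  "veronese_curve d = {proj_point (L ^ d) | L. L \<in> forms 1 \<and> L \<noteq> 0}"

definition proj_plane :: "nat \<Rightarrow> nat \<Rightarrow> 'a::field poly poly set set \<Rightarrow> bool" where
  "proj_plane d k \<Lambda> \<longleftrightarrow>
     (\<exists>W. form.subspace W \<and> W \<subseteq> forms d \<and> form.dim W = k + 1 \<and> \<Lambda> = proj_space W)"

text \<open>
  A point of projective space is the set of its representatives, so \<open>\<Union>P\<close> is the set of all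
  vectors representing points of \<open>P\<close>.
\<close>

definition proj_span :: "'a::field poly poly set set \<Rightarrow> 'a poly poly set set" where
  "proj_span P = proj_space (form.span (\<Union>P))"

definition secant_plane :: "nat \<Rightarrow> nat \<Rightarrow> 'a::field poly poly set set \<Rightarrow> bool" where
  "secant_plane d k \<Lambda> \<longleftrightarrow>
     proj_plane d k \<Lambda> \<and> (\<exists>P \<subseteq> veronese_curve d. card P = k + 1 \<and> \<Lambda> = proj_span P)"

end

theory Submission
  imports Defs "Jordan_Normal_Form.Determinant"
begin

hide_const (open) Module.smult

text \<open>
  The proof is Sylvester's: the rank of a binary form is read off from its apolar forms. After
  its coefficients are divided by binomial coefficients, a form \<open>q\<close> of degree \<open>d\<close> becomes a
  linear functional on polynomials of degree at most \<open>d\<close>, and the functional of \<open>L\<^sup>d\<close> is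
  evaluation at the point \<open>L\<close> of the projective line. A form \<open>g\<close> of degree \<open>r\<close> is apolar to \<open>q\<close>
  if this functional kills all multiples of \<open>g\<close> of degree \<open>d\<close>. For \<open>q \<noteq> 0\<close> let \<open>r\<close> be the least degree
  of a nonzero apolar form \<open>g\<close>; counting equations gives \<open>r \<le> d div 2 + 1\<close>.

  The rank is \<open>r\<close> or \<open>d - r + 2\<close> (\<open>sylvester_rank\<close>). If \<open>q\<close> is a sum of \<open>s\<close> powers of pairwise
  independent linear forms, the product of the \<open>s\<close> corresponding linear factors is apolar, so
  \<open>s \<ge> r\<close>. If moreover \<open>s + r \<le> d + 1\<close>, evaluations at the \<open>s\<close> points are independent on
  polynomials of degree \<open>d - r\<close>, which forces \<open>g\<close> to vanish at all of them; hence \<open>s \<le> r\<close>. So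
  the rank is \<open>r\<close> or at least \<open>d - r + 2\<close>. The upper bound comes from the apolar forms of degree
  \<open>s = d - r + 2\<close>: by minimality of \<open>r\<close> they have no common zero
  (\<open>apolar_base_point_free\<close>), so in characteristic zero a general one in a suitable pencil has
  \<open>s\<close> distinct roots (\<open>finite_degenerate_pencil_members\<close>), and an apolar form with \<open>s\<close> distinct
  roots exhibits \<open>q\<close> as a combination of \<open>s\<close> powers (\<open>power_sum_of_distinct_roots\<close>).

  The closure of the locus of rank \<open>r\<close>, for \<open>1 \<le> r\<close> and \<open>2 * r \<le> d + 2\<close>, is the set \<open>apolar_locus d r\<close> of
  forms with a nonzero apolar form of degree \<open>r\<close> (\<open>closure_rank_locus\<close>). This set is closed
  because it is a degeneracy locus of catalecticant matrices. It lies in the closure because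
  its members are limits: a curve of apolar forms \<open>g + t h\<close> with distinct roots for general
  \<open>t\<close> is followed by a curve of forms \<open>q\<^sub>t\<close> with \<open>q\<^sub>0 = q\<close>, and a sum of fewer than \<open>r\<close> powers is
  a limit of sums of exactly \<open>r\<close> powers in general position.

  The difference of two consecutive closures therefore consists of the forms whose least
  apolar degree is \<open>k + 1\<close>, up to the zero form, and these have rank \<open>k + 1\<close> or \<open>d - k + 1\<close>.
  Lying on a secant plane means being a combination of the powers of \<open>k + 1\<close> distinct points, and over an
  algebraically closed field the coefficients can be absorbed into the linear forms.
\<close>

section \<open>Linear functionals on spaces of polynomials\<close>

definition linear_functional :: "('a::field poly \<Rightarrow> 'a) \<Rightarrow> bool" where
  "linear_functional f \<longleftrightarrow> (\<forall>p q c. f (p + smult c q) = f p + c * f q)"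

definition poly_subspace :: "'a::field poly set \<Rightarrow> bool" where
  "poly_subspace V \<longleftrightarrow> 0 \<in> V \<and> (\<forall>p\<in>V. \<forall>q\<in>V. \<forall>c. p + smult c q \<in> V)"

text \<open>
  Duality for finitely many functionals on a possibly infinite-dimensional space. It
  produces the coefficients of a form as a combination of powers, the multiplier \<open>w\<close> in
  \<open>apolar_base_point_free\<close>, and the left inverse in \<open>apolar_locus_separated\<close>.
\<close>

lemma functional_in_span:
  fixes n :: nat
  assumes "poly_subspace V" "\<And>i. i < n \<Longrightarrow> linear_functional (f i)" "linear_functional g"
    and "\<And>p. p \<in> V \<Longrightarrow> (\<And>i. i < n \<Longrightarrow> f i p = 0) \<Longrightarrow> g p = 0"
  shows "\<exists>c. \<forall>p\<in>V. g p = (\<Sum>i<n. c i * f i p)"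
  using assms
proof (induction n arbitrary: V)
  case 0
  then show ?case by simp
next
  case (Suc n)
  define V' where "V' = {p \<in> V. f n p = 0}"
  have lin: "f i (p + smult c q) = f i p + c * f i q" if "i < Suc n" for i p q c
    using Suc.prems(2)[OF that] by (simp add: linear_functional_def)
  have "f n 0 = 0" using lin[of n 0 "-1" 0] by simp
  then have sub': "poly_subspace V'"
    using Suc.prems(1) lin[of n] by (auto simp: poly_subspace_def V'_def)
  have "\<exists>c. \<forall>p\<in>V'. g p = (\<Sum>i<n. c i * f i p)"
  proof (rule Suc.IH[OF sub' _ Suc.prems(3)])
    show "linear_functional (f i)" if "i < n" for i using Suc.prems(2) that by simp
    show "g p = 0" if "p \<in> V'" and "\<And>i. i < n \<Longrightarrow> f i p = 0" for p
      using Suc.prems(4)[of p] that by (auto simp: V'_def less_Suc_eq)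
  qed
  then obtain c where c: "\<And>p. p \<in> V' \<Longrightarrow> g p = (\<Sum>i<n. c i * f i p)" by blast
  define e where "e p = g p - (\<Sum>i<n. c i * f i p)" for p
  have e_lin: "e (p + smult a q) = e p + a * e q" for p q a
  proof -
    have "(\<Sum>i<n. c i * f i (p + smult a q)) = (\<Sum>i<n. c i * f i p) + a * (\<Sum>i<n. c i * f i q)"
      by (simp add: lin algebra_simps sum.distrib sum_distrib_left)
    moreover have "g (p + smult a q) = g p + a * g q"
      using Suc.prems(3) by (simp add: linear_functional_def)
    ultimately show ?thesis by (simp add: e_def algebra_simps)
  qed
  have "\<exists>b. \<forall>p\<in>V. e p = b * f n p"
  proof (cases "\<forall>p\<in>V. f n p = 0")
    case True
    then have "\<forall>p\<in>V. e p = 0 * f n p" using c by (auto simp: e_def V'_def)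
    then show ?thesis ..
  next
    case False
    then obtain v where v: "v \<in> V" "f n v \<noteq> 0" by blast
    have "e p = (e v / f n v) * f n p" if p: "p \<in> V" for p
    proof -
      have "p + smult (- f n p / f n v) v \<in> V"
        using Suc.prems(1) p v(1) unfolding poly_subspace_def by blast
      moreover have "f n (p + smult (- f n p / f n v) v) = 0"
        using v(2) by (subst lin) auto
      ultimately have "p + smult (- f n p / f n v) v \<in> V'" by (simp add: V'_def)
      then have "e (p + smult (- f n p / f n v) v) = 0" using c by (simp add: e_def)
      then have "e p + (- f n p / f n v) * e v = 0" by (simp only: e_lin)
      then show ?thesis using v by (simp add: field_simps)
    qed
    then show ?thesis by blast
  qed
  then obtain b where b: "\<And>p. p \<in> V \<Longrightarrow> e p = b * f n p" by blast
  have "g p = (\<Sum>i<Suc n. (c(n := b)) i * f i p)" if "p \<in> V" for p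
    using b[OF that] by (simp add: e_def algebra_simps)
  then show ?case by blast
qed

lemma poly_subspace_degree_le: "poly_subspace {p. degree p \<le> n}"
  by (auto simp: poly_subspace_def intro!: degree_add_le order_trans[OF degree_smult_le])

lemma linear_functional_poly: "linear_functional (\<lambda>p. poly p t)"
  by (simp add: linear_functional_def)

lemma linear_functional_coeff: "linear_functional (\<lambda>p. coeff p n)"
  by (simp add: linear_functional_def)

text \<open>
  A vector space over an infinite field is not a finite union of proper subspaces.
\<close>

lemma exists_avoiding_points:
  fixes V :: "'a::field_char_0 poly set"
  assumes V: "poly_subspace V" and "finite T"
    and "\<And>t. t \<in> T \<Longrightarrow> \<exists>f\<in>V. poly f t \<noteq> 0"
  shows "\<exists>f\<in>V. \<forall>t\<in>T. poly f t \<noteq> 0"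
  using assms(2,3)
proof (induction rule: finite_induct)
  case empty
  then show ?case using V by (auto simp: poly_subspace_def)
next
  case (insert u T)
  then obtain f where f: "f \<in> V" "\<forall>t\<in>T. poly f t \<noteq> 0" by auto
  obtain g where g: "g \<in> V" "poly g u \<noteq> 0" using insert.prems by blast
  define B where "B = insert (- poly f u / poly g u) ((\<lambda>t. - poly f t / poly g t) ` T)"
  have "finite B" using insert.hyps by (simp add: B_def)
  then obtain c where c: "c \<notin> insert 0 B"
    using ex_new_if_finite[of "insert 0 B"] infinite_UNIV_char_0 by auto
  have "poly (f + smult c g) t \<noteq> 0" if "t \<in> insert u T" for t
  proof (cases "poly g t = 0")
    case True
    then have "t \<in> T" using g that by auto
    then show ?thesis using f True by simp
  next
    case False
    have "c \<noteq> - poly f t / poly g t" using c that by (auto simp: B_def)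
    then have "c * poly g t \<noteq> - poly f t" using False by (metis nonzero_eq_divide_eq)
    then show ?thesis by (auto simp: add_eq_0_iff2)
  qed
  moreover have "f + smult c g \<in> V" using V f g by (simp add: poly_subspace_def)
  ultimately show ?case by blast
qed

section \<open>Pencils of polynomials\<close>

text \<open>
  Over an algebraically closed field a polynomial without multiple roots splits into distinct
  linear factors.
\<close>

lemma card_roots_eq_degree:
  fixes p :: "'a::{alg_closed_field,field_char_0} poly"
  assumes "p \<noteq> 0" "\<And>x. poly p x = 0 \<Longrightarrow> poly (pderiv p) x \<noteq> 0"
  shows "card {x. poly p x = 0} = degree p"
proof -
  obtain A where A: "size A = degree p" "p = smult (lead_coeff p) (\<Prod>x\<in>#A. [:-x, 1:])"
    using alg_closed_imp_factorization[OF assms(1)] by blast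
  have roots: "{x. poly p x = 0} = set_mset A"
    using assms(1) by (subst A(2)) (auto simp: poly_prod_mset prod_mset_zero_iff)
  have "count A x \<le> 1" for x
  proof (rule ccontr)
    assume "\<not> count A x \<le> 1"
    then have "{#x, x#} \<subseteq># A" by (auto simp: subseteq_mset_def)
    then obtain B where B: "A = {#x, x#} + B" by (metis subset_mset.le_iff_add)
    have "\<exists>r. p = [:-x,1:] * ([:-x,1:] * r)"
      by (rule exI[of _ "smult (lead_coeff p) (\<Prod>x\<in>#B. [:-x, 1:])"])
         (subst A(2), simp add: B)
    then obtain r where r: "p = [:-x,1:] * ([:-x,1:] * r)" by blast
    have "poly p x = 0" "poly (pderiv p) x = 0" 
      by (simp_all only: r pderiv_mult poly_add poly_mult) simp_all
    then show False using assms(2) by blast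
  qed
  then have "size A = card (set_mset A)"
    unfolding size_multiset_overloaded_eq
    by (metis (no_types, lifting) card_eq_sum count_greater_eq_one_iff le_antisym sum.cong)
  then show ?thesis using A(1) roots by simp
qed

text \<open>
  This is Bertini's theorem for a pencil without base points on the line. A multiple root \<open>x\<close> of
  \<open>f + t h\<close> is a root of the Wronskian of \<open>f\<close> and \<open>h\<close>, and it determines \<open>t = - f(x) / h(x)\<close>.
  So finitely many \<open>t\<close> are bad once the Wronskian is nonzero, and that is where
  characteristic zero enters. Asking one member to have full degree keeps all but one member
  from having a root at infinity.
\<close>

lemma finite_degenerate_pencil_members:
  fixes f h :: "'a::{alg_closed_field,field_char_0} poly"
  assumes s: "degree f \<le> s" "degree h = s" "s \<ge> 1"
    and no_common: "\<And>x. poly f x = 0 \<Longrightarrow> poly h x \<noteq> 0"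
  shows "finite {t. \<not> (degree (f + smult t h) = s \<and> card {x. poly (f + smult t h) x = 0} = s)}"
proof -
  have h0: "h \<noteq> 0" using s by auto
  define W where "W = f * pderiv h - pderiv f * h"
  obtain x where x: "poly h x = 0" using alg_closed_imp_poly_has_root[of h] s by auto
  have "f \<noteq> 0" "poly f x \<noteq> 0" using no_common x by auto
  have "W \<noteq> 0"
  proof
    assume "W = 0"
    then have eq: "f * pderiv h = pderiv f * h" by (simp add: W_def)
    have h': "pderiv h \<noteq> 0" using s by (simp add: pderiv_eq_0_iff)
    \<comment> \<open>If the Wronskian vanished, the orders of \<open>f h'\<close> and \<open>f' h\<close> at the root \<open>x\<close> of \<open>h\<close> would agree;
      but differentiation lowers the order of \<open>h\<close> at \<open>x\<close>.\<close>
    have "order x (f * pderiv h) = order x (pderiv h)"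
      using h' \<open>f \<noteq> 0\<close> \<open>poly f x \<noteq> 0\<close> by (simp add: order_mult order_0I)
    moreover have "order x (pderiv f * h) \<ge> order x h"
      using eq h' \<open>f \<noteq> 0\<close> by (metis le_add2 no_zero_divisors order_mult)
    moreover have "order x h = Suc (order x (pderiv h))"
      using h' x h0 by (intro order_pderiv) (simp_all add: order_root)
    ultimately show False using eq by simp
  qed
  define bad where "bad = insert (- coeff f s / lead_coeff h) ((\<lambda>x. - poly f x / poly h x) ` {x. poly W x = 0})"
  have "finite bad" using poly_roots_finite[OF \<open>W \<noteq> 0\<close>] by (simp add: bad_def)
  moreover have "degree (f + smult t h) = s \<and> card {x. poly (f + smult t h) x = 0} = s"
    if t: "t \<notin> bad" for t
  proof -
    let ?p = "f + smult t h"
    have "t \<noteq> - coeff f s / lead_coeff h" using t by (simp add: bad_def)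
    then have "t * lead_coeff h \<noteq> - coeff f s" using h0 by (metis leading_coeff_0_iff nonzero_eq_divide_eq)
    then have top: "coeff ?p s \<noteq> 0" using s(2) by (auto simp: add_eq_0_iff2)
    have deg: "degree ?p = s"
      using top s by (intro antisym le_degree degree_add_le order_trans[OF degree_smult_le]) auto
    have "poly (pderiv ?p) x \<noteq> 0" if px: "poly ?p x = 0" for x
    proof
      assume dx: "poly (pderiv ?p) x = 0"
      have fx: "poly f x = - t * poly h x" using px by (simp add: add_eq_0_iff2)
      have hx: "poly h x \<noteq> 0" using fx no_common[of x] by auto
      have "poly (pderiv f) x = - t * poly (pderiv h) x"
        using dx by (simp add: pderiv_add pderiv_smult add_eq_0_iff2)
      then have "poly W x = 0" using fx by (simp add: W_def)
      moreover have "t = - poly f x / poly h x" using fx hx by simp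
      ultimately show False using t by (auto simp: bad_def)
    qed
    moreover have "?p \<noteq> 0" using top by (metis coeff_0)
    ultimately show ?thesis using card_roots_eq_degree[of ?p] deg by simp
  qed
  then have "{t. \<not> (degree (f + smult t h) = s \<and> card {x. poly (f + smult t h) x = 0} = s)} \<subseteq> bad"
    by blast
  ultimately show ?thesis using finite_subset by blast
qed

section \<open>Binary forms and the apolarity pairing\<close>

text \<open>
  Dividing by the binomial coefficients turns the coefficients of \<open>(l x + m y)\<^sup>d\<close> into the
  monomials \<open>l\<^sup>d\<^sup>-\<^sup>i m\<^sup>i\<close>, so that pairing with a power of a linear form is evaluation at a point.
  Test polynomials are dehomogenised: a binary form of degree \<open>n\<close> is a polynomial of degree
  at most \<open>n\<close>, and a drop in degree is a zero at infinity.
\<close>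

definition dual_coeff :: "nat \<Rightarrow> 'a::field poly poly \<Rightarrow> nat \<Rightarrow> 'a" where
  "dual_coeff d q i = coeff (coeff q i) (d - i) / of_nat (d choose i)"

definition pairing :: "nat \<Rightarrow> 'a::field poly poly \<Rightarrow> 'a poly \<Rightarrow> 'a" where
  "pairing d q p = (\<Sum>i\<le>d. coeff p i * dual_coeff d q i)"

definition form_of :: "nat \<Rightarrow> (nat \<Rightarrow> 'a::field) \<Rightarrow> 'a poly poly" where
  "form_of d b = (\<Sum>i\<le>d. monom (monom (of_nat (d choose i) * b i) (d - i)) i)"

lemma coeff_form_of:
  "coeff (coeff (form_of d b) j) i = (if i + j = d then of_nat (d choose j) * b j else 0)"
proof -
  have "coeff (coeff (form_of d b) j) i =
      (\<Sum>k\<le>d. if k = j then (if d - j = i then of_nat (d choose j) * b j else 0) else 0)"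
    unfolding form_of_def coeff_sum by (intro sum.cong) auto
  also have "\<dots> = (if i + j = d then of_nat (d choose j) * b j else 0)" by auto
  finally show ?thesis .
qed

lemma form_of_in_forms: "form_of d b \<in> forms d"
  by (simp add: forms_def coeff_form_of)

lemma dual_coeff_form_of:
  fixes b :: "nat \<Rightarrow> 'a::field_char_0"
  shows "i \<le> d \<Longrightarrow> dual_coeff d (form_of d b) i = b i"
  by (simp add: dual_coeff_def coeff_form_of)

lemma forms_eqI:
  fixes q q' :: "'a::field_char_0 poly poly"
  assumes "q \<in> forms d" "q' \<in> forms d" "\<And>i. i \<le> d \<Longrightarrow> dual_coeff d q i = dual_coeff d q' i"
  shows "q = q'"
proof (intro poly_eqI)
  fix i j
  show "coeff (coeff q j) i = coeff (coeff q' j) i"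
  proof (cases "i + j = d")
    case True
    then show ?thesis using assms(3)[of j] by (auto simp: dual_coeff_def)
  next
    case False
    then show ?thesis using assms(1,2) unfolding forms_def by (metis (mono_tags, lifting) mem_Collect_eq)
  qed
qed

lemma forms_0: "0 \<in> forms d"
  by (simp add: forms_def)

lemma forms_add: "p \<in> forms d \<Longrightarrow> q \<in> forms d \<Longrightarrow> p + q \<in> forms d"
  unfolding forms_def by (auto, metis add_0)

lemma forms_scale: "q \<in> forms d \<Longrightarrow> scale_form c q \<in> forms d"
  by (auto simp: forms_def scale_form_def)

lemma forms_sum: "(\<And>i. i \<in> I \<Longrightarrow> f i \<in> forms d) \<Longrightarrow> sum f I \<in> forms d"
  by (induction I rule: infinite_finite_induct) (auto simp: forms_0 forms_add)

lemma dual_coeff_0 [simp]: "dual_coeff d 0 i = 0"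
  by (simp add: dual_coeff_def)

lemma dual_coeff_sum: "dual_coeff d (sum f I) i = (\<Sum>x\<in>I. dual_coeff d (f x) i)"
  by (simp add: dual_coeff_def coeff_sum sum_divide_distrib)

lemma dual_coeff_scale: "dual_coeff d (scale_form c q) i = c * dual_coeff d q i"
  by (simp add: dual_coeff_def scale_form_def)

lemma linear_functional_pairing: "linear_functional (pairing d q)"
  by (simp add: linear_functional_def pairing_def algebra_simps sum.distrib sum_distrib_left)

lemma pairing_0_right [simp]: "pairing d q 0 = 0"
  by (simp add: pairing_def)

lemma pairing_0_left [simp]: "pairing d 0 p = 0"
  by (simp add: pairing_def)

lemma pairing_smult: "pairing d q (smult c p) = c * pairing d q p"
  by (simp add: pairing_def sum_distrib_left mult.assoc)

lemma pairing_add: "pairing d q (p + p') = pairing d q p + pairing d q p'"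
  by (simp add: pairing_def algebra_simps sum.distrib)

lemma pairing_sum: "pairing d q (sum f I) = (\<Sum>x\<in>I. pairing d q (f x))"
  by (induction I rule: infinite_finite_induct) (simp_all add: pairing_add)

lemma pairing_sum_left: "pairing d (sum f I) p = (\<Sum>x\<in>I. pairing d (f x) p)"
  unfolding pairing_def dual_coeff_sum sum_distrib_left by (rule sum.swap)

lemma pairing_scale_left: "pairing d (scale_form c q) p = c * pairing d q p"
  unfolding pairing_def dual_coeff_scale sum_distrib_left by (simp add: mult_ac)

lemma pairing_monom: "i \<le> d \<Longrightarrow> pairing d q (monom 1 i) = dual_coeff d q i"
  by (simp add: pairing_def if_distrib[of "\<lambda>x. x * _"] cong: if_cong)

lemma pairing_eq_0_imp:
  fixes q :: "'a::field_char_0 poly poly"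
  assumes "q \<in> forms d" "\<And>p. degree p \<le> d \<Longrightarrow> pairing d q p = 0"
  shows "q = 0"
proof (rule forms_eqI[OF assms(1) forms_0])
  fix i assume "i \<le> d"
  then show "dual_coeff d q i = dual_coeff d 0 i"
    using assms(2)[of "monom 1 i"] by (simp add: pairing_monom degree_monom_eq)
qed

section \<open>Linear forms as points\<close>

definition lin_form :: "'a::field \<times> 'a \<Rightarrow> 'a poly poly" where
  "lin_form P = [:[:0, fst P:], [:snd P:]:]"

text \<open>
  The value at \<open>P\<close> of the binary form of degree \<open>n\<close> that \<open>p\<close> dehomogenises. Points with first
  coordinate zero represent infinity, where only the coefficient of degree \<open>n\<close> is seen.
\<close>

definition hval :: "nat \<Rightarrow> 'a::field \<times> 'a \<Rightarrow> 'a poly \<Rightarrow> 'a" where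
  "hval n P p = (\<Sum>i\<le>n. coeff p i * (fst P ^ (n - i) * snd P ^ i))"

lemma lin_form_in_forms: "lin_form P \<in> forms 1"
  by (auto simp: forms_def lin_form_def coeff_pCons split: nat.splits)

lemma forms_1_cases:
  assumes "L \<in> forms 1"
  obtains P where "L = lin_form P"
proof
  have z: "coeff (coeff L j) i = 0" if "i + j \<noteq> 1" for i j
    using assms that by (auto simp: forms_def)
  show "L = lin_form (coeff (coeff L 0) 1, coeff (coeff L 1) 0)"
  proof (intro poly_eqI)
    fix i j
    show "coeff (coeff L j) i = coeff (coeff (lin_form (coeff (coeff L 0) 1, coeff (coeff L 1) 0)) j) i"
      using z[of i j] by (auto simp: lin_form_def coeff_pCons split: nat.splits)
  qed
qed

lemma lin_form_power: "lin_form P ^ d = form_of d (\<lambda>i. fst P ^ (d - i) * snd P ^ i)"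
proof -
  have "lin_form P = monom (monom (snd P) 0) 1 + monom (monom (fst P) 1) 0"
    by (simp add: lin_form_def monom_altdef)
  then have "lin_form P ^ d = (\<Sum>k\<le>d. of_nat (d choose k) *
      monom (monom (snd P) 0) 1 ^ k * monom (monom (fst P) 1) 0 ^ (d - k))"
    by (simp only: binomial_ring)
  also have "\<dots> = form_of d (\<lambda>i. fst P ^ (d - i) * snd P ^ i)"
    unfolding form_of_def
    by (intro sum.cong refl)
      (simp add: monom_power mult_monom of_nat_poly smult_monom mult_ac)
  finally show ?thesis .
qed

lemma lin_form_power_in_forms: "lin_form P ^ d \<in> forms d"
  by (simp add: lin_form_power form_of_in_forms)

lemma dual_coeff_lin_form_power:
  fixes P :: "'a::field_char_0 \<times> 'a"
  shows "i \<le> d \<Longrightarrow> dual_coeff d (lin_form P ^ d) i = fst P ^ (d - i) * snd P ^ i"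
  by (simp add: lin_form_power dual_coeff_form_of)

lemma pairing_lin_form_power:
  fixes P :: "'a::field_char_0 \<times> 'a"
  shows "pairing d (lin_form P ^ d) p = hval d P p"
  unfolding pairing_def hval_def by (intro sum.cong) (simp_all add: dual_coeff_lin_form_power)

lemma hval_finite_point:
  assumes "fst P \<noteq> 0" "degree p \<le> n"
  shows "hval n P p = fst P ^ n * poly p (snd P / fst P)"
proof -
  have poly: "poly p (snd P / fst P) = (\<Sum>i\<le>n. coeff p i * (snd P / fst P) ^ i)"
    unfolding poly_altdef using assms(2)
    by (intro sum.mono_neutral_left) (auto simp: coeff_eq_0)
  have monomial: "fst P ^ n * (coeff p i * (snd P / fst P) ^ i) = coeff p i * (fst P ^ (n - i) * snd P ^ i)"
    if "i \<le> n" for i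
    using assms(1) that by (simp add: power_divide power_diff)
  show ?thesis
    unfolding hval_def poly sum_distrib_left by (intro sum.cong refl monomial[symmetric]) simp
qed

lemma hval_infinite_point:
  assumes "fst P = 0"
  shows "hval n P p = coeff p n * snd P ^ n"
proof -
  have "hval n P p = (\<Sum>i\<le>n. if i = n then coeff p n * snd P ^ n else 0)"
    unfolding hval_def using assms by (intro sum.cong) (auto simp: power_0_left)
  then show ?thesis by simp
qed

lemma coeff_mult_top:
  fixes f g :: "'a::comm_semiring_0 poly"
  assumes "degree f \<le> a" "degree g \<le> b"
  shows "coeff (f * g) (a + b) = coeff f a * coeff g b"
proof -
  have "coeff (f * g) (a + b) = (\<Sum>i\<le>a + b. if i = a then coeff f a * coeff g b else 0)"
    unfolding coeff_mult
  proof (intro sum.cong refl)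
    fix i assume "i \<in> {..a + b}"
    then have "i = a \<or> i > a \<or> a + b - i > b" by auto
    then show "coeff f i * coeff g (a + b - i) = (if i = a then coeff f a * coeff g b else 0)"
      using assms by (auto simp: coeff_eq_0)
  qed
  then show ?thesis by simp
qed

lemma hval_mult:
  assumes "degree f \<le> a" "degree g \<le> b"
  shows "hval (a + b) P (f * g) = hval a P f * hval b P g"
proof (cases "fst P = 0")
  case True
  then show ?thesis by (simp add: hval_infinite_point coeff_mult_top[OF assms] power_add)
next
  case False
  have "degree (f * g) \<le> a + b" using degree_mult_le[of f g] assms by linarith
  then show ?thesis using False assms by (simp add: hval_finite_point power_add)
qed

lemma hval_power:
  assumes "degree f \<le> 1"
  shows "degree (f ^ n) \<le> n \<and> hval n P (f ^ n) = hval 1 P f ^ n"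
proof (induction n)
  case 0
  then show ?case by (simp add: hval_def)
next
  case (Suc n)
  then show ?case
    using hval_mult[of f 1 "f ^ n" n P] degree_mult_le[of f "f ^ n"] assms by auto
qed

lemma hval_prod:
  assumes "finite I" "\<And>i. i \<in> I \<Longrightarrow> degree (f i) \<le> 1"
  shows "degree (prod f I) \<le> card I \<and> hval (card I) P (prod f I) = (\<Prod>i\<in>I. hval 1 P (f i))"
  using assms
proof (induction rule: finite_induct)
  case empty
  then show ?case by (simp add: hval_def)
next
  case (insert i I)
  then show ?case
    using hval_mult[of "f i" 1 "prod f I" "card I" P] degree_mult_le[of "f i" "prod f I"] by fastforce
qed

definition cross :: "'a::field \<times> 'a \<Rightarrow> 'a \<times> 'a \<Rightarrow> 'a" where
  "cross P Q = fst P * snd Q - snd P * fst Q"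

text \<open>
  The linear binary form with a zero exactly at \<open>P\<close>; for the point at infinity it is
  a nonzero constant.
\<close>

definition root_at :: "'a::field \<times> 'a \<Rightarrow> 'a poly" where
  "root_at P = [:- snd P, fst P:]"

lemma degree_root_at: "degree (root_at P) \<le> 1"
  by (simp add: root_at_def)

lemma hval_root_at: "hval 1 Q (root_at P) = cross P Q"
  by (simp add: hval_def root_at_def cross_def algebra_simps)

definition general_position :: "nat \<Rightarrow> (nat \<Rightarrow> 'a::field \<times> 'a) \<Rightarrow> bool" where
  "general_position s P \<longleftrightarrow> (\<forall>i<s. P i \<noteq> (0, 0)) \<and> (\<forall>i<s. \<forall>j<s. i \<noteq> j \<longrightarrow> cross (P i) (P j) \<noteq> 0)"

text \<open>
  Evaluations at \<open>s\<close> distinct points are linearly independent on forms of degree \<open>n \<ge> s - 1\<close>: multiply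
  the linear factors of the other points, and fill up the degree with a factor that does not
  vanish at the chosen point.
\<close>

lemma exists_separating_polynomial:
  assumes gp: "general_position s P" and "j < s" "s \<le> n + 1"
  shows "\<exists>h. degree h \<le> n \<and> hval n (P j) h \<noteq> 0 \<and> (\<forall>i<s. i \<noteq> j \<longrightarrow> hval n (P i) h = 0)"
proof -
  define I where "I = {..<s} - {j}"
  have I: "finite I" "card I + (n - card I) = n" using assms by (auto simp: I_def)
  define k :: "'a poly" where "k = (if fst (P j) = 0 then [:0, 1:] else 1)"
  have k: "degree k \<le> 1" "hval 1 (P j) k \<noteq> 0"
    using gp assms(2) by (auto simp: k_def hval_def general_position_def prod_eq_iff)
  define h where "h = (\<Prod>i\<in>I. root_at (P i)) * k ^ (n - card I)"
  note prod = hval_prod[of I "\<lambda>i. root_at (P i)", OF I(1) degree_root_at]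
  have val: "hval n Q h = (\<Prod>i\<in>I. cross (P i) Q) * hval 1 Q k ^ (n - card I)" for Q
    using hval_mult[of "\<Prod>i\<in>I. root_at (P i)" "card I" "k ^ (n - card I)" "n - card I" Q]
      prod[of Q] hval_power[OF k(1), of "n - card I" Q] I(2)
    by (simp add: h_def hval_root_at[unfolded One_nat_def])
  have "degree h \<le> n"
    using degree_mult_le[of "\<Prod>i\<in>I. root_at (P i)" "k ^ (n - card I)"] prod
      hval_power[OF k(1), of "n - card I"] I(2) unfolding h_def by fastforce
  moreover have "hval n (P j) h \<noteq> 0"
    unfolding val using k gp assms(2) I(1) by (auto simp: general_position_def I_def)
  moreover have "hval n (P i) h = 0" if "i < s" "i \<noteq> j" for i
  proof -
    have "i \<in> I" "cross (P i) (P i) = 0" using that by (auto simp: I_def cross_def)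
    then have "(\<Prod>l\<in>I. cross (P l) (P i)) = 0" using I(1) by auto
    then show ?thesis by (simp add: val)
  qed
  ultimately show ?thesis by blast
qed

text \<open>
  The finite zeros are roots of \<open>g\<close>, and a zero at infinity costs one degree.
\<close>

lemma general_position_zeros_le:
  assumes gp: "general_position s P" and g: "g \<noteq> 0" "degree g \<le> r"
    and zeros: "\<And>i. i < s \<Longrightarrow> hval r (P i) g = 0"
  shows "s \<le> r"
proof -
  define I where "I = {i. i < s \<and> fst (P i) \<noteq> 0}"
  define J where "J = {i. i < s \<and> fst (P i) = 0}"
  define t where "t i = snd (P i) / fst (P i)" for i
  have gpD: "P i \<noteq> (0,0)" if "i < s" for i using gp that by (simp add: general_position_def)
  have cr: "cross (P i) (P j) \<noteq> 0" if "i < s" "j < s" "i \<noteq> j" for i j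
    using gp that by (simp add: general_position_def)
  have "inj_on t I"
  proof (rule inj_onI, rule ccontr)
    fix i j assume "i \<in> I" "j \<in> I" "t i = t j" "i \<noteq> j"
    then show False using cr[of i j] by (auto simp: I_def t_def cross_def field_simps)
  qed
  moreover have "poly g (t i) = 0" if "i \<in> I" for i
    using zeros[of i] that hval_finite_point[of "P i" g r] g(2) by (simp add: I_def t_def)
  then have "t ` I \<subseteq> {x. poly g x = 0}" by blast
  ultimately have "card I \<le> card {x. poly g x = 0}"
    using poly_roots_finite[OF g(1)] by (metis card_image card_mono)
  then have I: "card I \<le> degree g" using card_poly_roots_bound[OF g(1)] by linarith
  have J: "degree g + card J \<le> r"
  proof (cases "J = {}")
    case True
    then show ?thesis using g(2) by simp
  next
    case False
    then obtain i where i: "i \<in> J" by blast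
    have "l = i" if "l \<in> J" for l
      using that i cr[of l i] by (auto simp: J_def cross_def)
    then have "J = {i}" using i by blast
    moreover have "snd (P i) \<noteq> 0" using gpD i by (auto simp: J_def prod_eq_iff)
    then have "coeff g r = 0" using zeros[of i] i by (auto simp: J_def hval_infinite_point)
    then have "degree g \<noteq> r" using g(1) by auto
    ultimately show ?thesis using g(2) by simp
  qed
  have "{..<s} = I \<union> J" "I \<inter> J = {}" by (auto simp: I_def J_def)
  then have "s = card I + card J" by (metis card_Un_disjoint card_lessThan finite_Un finite_lessThan)
  then show ?thesis using I J by simp
qed

section \<open>Apolar polynomials\<close>

text \<open>
  Here \<open>g\<close> stands for a binary form of degree \<open>r\<close>, and \<open>h * g\<close> runs through its multiples of
  degree \<open>d\<close>. For \<open>r > d\<close> the condition on \<open>h\<close> is empty.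
\<close>

definition apolar :: "nat \<Rightarrow> 'a::field poly poly \<Rightarrow> nat \<Rightarrow> 'a poly \<Rightarrow> bool" where
  "apolar d q r g \<longleftrightarrow> degree g \<le> r \<and> (\<forall>h. degree h + r \<le> d \<longrightarrow> pairing d q (h * g) = 0)"

lemma apolarI_monom:
  assumes "degree g \<le> r" "\<And>i. i + r \<le> d \<Longrightarrow> pairing d q (monom 1 i * g) = 0"
  shows "apolar d q r g"
  unfolding apolar_def
proof (intro conjI allI impI assms(1))
  fix h :: "'a poly" assume h: "degree h + r \<le> d"
  have "h * g = (\<Sum>i\<le>degree h. smult (coeff h i) (monom 1 i * g))"
    by (subst (1) poly_as_sum_of_monoms[symmetric])
       (simp add: sum_distrib_right smult_monom flip: mult_smult_left)
  moreover have "pairing d q (smult (coeff h i) (monom 1 i * g)) = 0" if "i \<le> degree h" for i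
    using assms(2)[of i] h that by (simp add: pairing_smult)
  ultimately show "pairing d q (h * g) = 0" by (simp add: pairing_sum)
qed

lemma apolar_mono: "apolar d q r g \<Longrightarrow> r \<le> r' \<Longrightarrow> apolar d q r' g"
  by (auto simp: apolar_def)

text \<open>
  Pairing \<open>h * g\<close> with the sum of powers gives the sum of the values of \<open>h * g\<close> at the points.
  If \<open>h\<close> separates one point from the others, only that value survives.
\<close>

lemma apolar_vanishes_at_points:
  fixes P :: "nat \<Rightarrow> 'a::field_char_0 \<times> 'a"
  assumes g: "apolar d (\<Sum>i<s. lin_form (P i) ^ d) r g"
    and gp: "general_position s P" and "s + r \<le> d + 1" "j < s"
  shows "hval r (P j) g = 0"
proof -
  have "s \<le> d - r + 1" "d - r + r = d" using assms(3,4) by linarith+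
  then obtain h where h: "degree h \<le> d - r" "hval (d - r) (P j) h \<noteq> 0"
    "\<And>i. i < s \<Longrightarrow> i \<noteq> j \<Longrightarrow> hval (d - r) (P i) h = 0"
    using exists_separating_polynomial[OF gp assms(4), of "d - r"] by blast
  have hg: "hval d Q (h * g) = hval (d - r) Q h * hval r Q g" for Q
    using hval_mult[of h "d - r" g r Q] g h(1) \<open>d - r + r = d\<close> by (simp add: apolar_def)
  have "0 = pairing d (\<Sum>i<s. lin_form (P i) ^ d) (h * g)"
    using g h(1) \<open>d - r + r = d\<close> by (simp add: apolar_def)
  also have "\<dots> = (\<Sum>i<s. hval (d - r) (P i) h * hval r (P i) g)"
    by (simp add: pairing_sum_left pairing_lin_form_power hg)
  also have "\<dots> = (\<Sum>i<s. if i = j then hval (d - r) (P j) h * hval r (P j) g else 0)"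
    using h(3) by (intro sum.cong) auto
  also have "\<dots> = hval (d - r) (P j) h * hval r (P j) g" using assms(4) by simp
  finally show ?thesis using h(2) by simp
qed

section \<open>Sums of powers and the rank\<close>

definition power_sum :: "nat \<Rightarrow> nat \<Rightarrow> 'a::field poly poly \<Rightarrow> bool" where
  "power_sum d r q \<longleftrightarrow> (\<exists>P. q = (\<Sum>i<r. lin_form (P i) ^ d))"

lemma power_sum_iff:
  "power_sum d r q \<longleftrightarrow> (\<exists>L. (\<forall>i<r. L i \<in> forms 1) \<and> q = (\<Sum>i<r. L i ^ d))"
proof
  assume "power_sum d r q"
  then obtain P where "q = (\<Sum>i<r. lin_form (P i) ^ d)" by (auto simp: power_sum_def)
  then show "\<exists>L. (\<forall>i<r. L i \<in> forms 1) \<and> q = (\<Sum>i<r. L i ^ d)"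
    using lin_form_in_forms by (intro exI[of _ "\<lambda>i. lin_form (P i)"]) blast
next
  assume "\<exists>L. (\<forall>i<r. L i \<in> forms 1) \<and> q = (\<Sum>i<r. L i ^ d)"
  then obtain L where L: "\<forall>i<r. L i \<in> forms 1" "q = (\<Sum>i<r. L i ^ d)" by blast
  then have "\<forall>i. \<exists>P. i < r \<longrightarrow> L i = lin_form P" using forms_1_cases by metis
  then obtain P where "\<And>i. i < r \<Longrightarrow> L i = lin_form (P i)" by metis
  then have "q = (\<Sum>i<r. lin_form (P i) ^ d)" unfolding L(2) by (intro sum.cong) auto
  then show "power_sum d r q" by (auto simp: power_sum_def)
qed

lemma form_rank_eq_Least: "form_rank d q = (LEAST r. 1 \<le> r \<and> power_sum d r q)"
  by (simp only: form_rank_def power_sum_iff)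

lemma power_sum_in_forms: "power_sum d r q \<Longrightarrow> q \<in> forms d"
  by (auto simp: power_sum_def intro!: forms_sum lin_form_power_in_forms)

lemma lin_form_scale_power:
  "lin_form (e * fst P, e * snd P) ^ d = scale_form (e ^ d) (lin_form P ^ d)"
proof -
  have "lin_form (e * fst P, e * snd P) = smult [:e:] (lin_form P)" by (simp add: lin_form_def)
  moreover have "[:e:] ^ d = [:e ^ d:]" by (induction d) (simp_all add: one_pCons mult.commute)
  ultimately show ?thesis by (simp add: smult_power scale_form_def)
qed

text \<open>
  Over an algebraically closed field every coefficient is a \<open>d\<close>-th power, so linear
  combinations of \<open>d\<close>-th powers are sums of \<open>d\<close>-th powers. Missing summands are supplied by
  the zero linear form.
\<close>

lemma power_sumI:
  fixes P :: "'b \<Rightarrow> 'a::alg_closed_field \<times> 'a"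
  assumes "d \<ge> 1" "finite I" "card I \<le> r"
    and q: "q = (\<Sum>x\<in>I. scale_form (c x) (lin_form (P x) ^ d))"
  shows "power_sum d r q"
proof -
  have "\<exists>y. y ^ d = c x" for x using nth_root_exists[of d] assms(1) by simp
  then obtain e where e: "\<And>x. e x ^ d = c x" by metis
  obtain b where b: "bij_betw b {..<card I} I"
    using ex_bij_betw_nat_finite[OF assms(2)] by (auto simp: atLeast0LessThan)
  define Q where "Q i = (if i < card I then (e (b i) * fst (P (b i)), e (b i) * snd (P (b i))) else (0, 0))" for i
  have "lin_form (0, 0) ^ d = 0" using assms(1) by (simp add: lin_form_def)
  then have "(\<Sum>i<r. lin_form (Q i) ^ d) = (\<Sum>i<card I. lin_form (Q i) ^ d)"
    using assms(3) by (intro sum.mono_neutral_right) (auto simp: Q_def)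
  also have "\<dots> = (\<Sum>i<card I. scale_form (c (b i)) (lin_form (P (b i)) ^ d))"
    by (intro sum.cong refl) (simp add: Q_def lin_form_scale_power e)
  also have "\<dots> = q" unfolding q by (rule sum.reindex_bij_betw[OF b])
  finally show ?thesis by (auto simp: power_sum_def)
qed

lemma power_sum_mono:
  fixes q :: "'a::alg_closed_field poly poly"
  assumes "power_sum d s q" "s \<le> r" "d \<ge> 1"
  shows "power_sum d r q"
proof -
  obtain P where "q = (\<Sum>i<s. lin_form (P i) ^ d)" using assms(1) by (auto simp: power_sum_def)
  then show ?thesis using assms(2,3)
    by (intro power_sumI[of d "{..<s}" r q "\<lambda>_. 1" P]) auto
qed

lemma form_rank_properties:
  fixes q :: "'a::alg_closed_field poly poly"
  assumes "power_sum d r q" "d \<ge> 1"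
  shows "1 \<le> form_rank d q" "power_sum d (form_rank d q) q"
proof -
  have "1 \<le> r + 1 \<and> power_sum d (r + 1) q" using power_sum_mono[OF assms(1), of "r + 1"] assms(2) by simp
  then have "1 \<le> form_rank d q \<and> power_sum d (form_rank d q) q"
    unfolding form_rank_eq_Least by (rule LeastI)
  then show "1 \<le> form_rank d q" "power_sum d (form_rank d q) q" by blast+
qed

lemma form_rank_le: "power_sum d r q \<Longrightarrow> 1 \<le> r \<Longrightarrow> form_rank d q \<le> r"
  unfolding form_rank_eq_Least by (rule Least_le) simp

text \<open>
  In a shortest representation no linear form is zero, and no two are proportional since
  proportional ones could be merged. The length \<open>s\<close> may be zero, which happens for \<open>q = 0\<close>.
\<close>

lemma power_sum_general_position:
  fixes q :: "'a::alg_closed_field poly poly"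
  assumes "power_sum d r q" "d \<ge> 1"
  obtains s P where "s \<le> r" "general_position s P" "q = (\<Sum>i<s. lin_form (P i) ^ d)"
proof -
  define s where "s = (LEAST s. power_sum d s q)"
  have s: "power_sum d s q" unfolding s_def by (rule LeastI[of _ r]) fact
  have "s \<le> r" unfolding s_def by (rule Least_le) fact
  have min: "\<not> power_sum d (s - 1) q" if "0 < s"
    using not_less_Least[of "s - 1" "\<lambda>s. power_sum d s q"] that by (auto simp: s_def)
  obtain P where P: "q = (\<Sum>i<s. lin_form (P i) ^ d)" using s by (auto simp: power_sum_def)
  have nz: "P i \<noteq> (0, 0)" if "i < s" for i
  proof
    assume "P i = (0, 0)"
    then have "lin_form (P i) ^ d = 0" using assms(2) by (simp add: lin_form_def)
    then have "q = (\<Sum>k\<in>{..<s} - {i}. scale_form 1 (lin_form (P k) ^ d))"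
      unfolding P using that by (subst sum.remove[of _ i]) auto
    then show False
      using power_sumI[OF assms(2), of "{..<s} - {i}" "s - 1" q "\<lambda>_. 1" P] min that by simp
  qed
  have "cross (P i) (P j) \<noteq> 0" if ij: "i < s" "j < s" "i \<noteq> j" for i j
  proof
    assume cr: "cross (P i) (P j) = 0"
    define a where "a = (if fst (P i) = 0 then snd (P j) / snd (P i) else fst (P j) / fst (P i))"
    have "P j = (a * fst (P i), a * snd (P i))"
      using cr nz[OF ij(1)] by (auto simp: a_def cross_def prod_eq_iff field_simps)
    then have pj: "lin_form (P j) ^ d = scale_form (a ^ d) (lin_form (P i) ^ d)"
      by (simp add: lin_form_scale_power)
    define c where "c k = (if k = i then 1 + a ^ d else 1)" for k
    have "q = lin_form (P j) ^ d + (lin_form (P i) ^ d + (\<Sum>k\<in>{..<s} - {j} - {i}. lin_form (P k) ^ d))"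
      unfolding P using ij by (subst sum.remove[of _ j], simp, simp, subst sum.remove[of _ i]) auto
    also have "\<dots> = scale_form (c i) (lin_form (P i) ^ d)
        + (\<Sum>k\<in>{..<s} - {j} - {i}. scale_form (c k) (lin_form (P k) ^ d))"
      by (simp add: pj c_def form.scale_left_distrib algebra_simps)
    also have "\<dots> = (\<Sum>k\<in>{..<s} - {j}. scale_form (c k) (lin_form (P k) ^ d))"
      using ij by (subst (2) sum.remove[of _ i]) auto
    finally show False
      using power_sumI[OF assms(2), of "{..<s} - {j}" "s - 1" q c P] min ij by simp
  qed
  then have "general_position s P" using nz by (simp add: general_position_def)
  then show ?thesis using that \<open>s \<le> r\<close> P by blast
qed

text \<open>
  The forms with an apolar form of degree \<open>r\<close>; for \<open>1 \<le> r\<close> and \<open>2 * r \<le> d + 2\<close> this is the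
  closure of the locus of rank \<open>r\<close> (\<open>closure_rank_locus\<close> below).
\<close>

definition apolar_locus :: "nat \<Rightarrow> nat \<Rightarrow> 'a::field poly poly set" where
  "apolar_locus d r = {q \<in> forms d. \<exists>g. g \<noteq> 0 \<and> apolar d q r g}"

lemma apolar_locus_mono: "r \<le> r' \<Longrightarrow> apolar_locus d r \<subseteq> apolar_locus d r'"
  unfolding apolar_locus_def using apolar_mono by blast

lemma zero_in_apolar_locus: "0 \<in> apolar_locus d r"
  by (auto simp: apolar_locus_def forms_0 apolar_def intro!: exI[of _ 1])

lemma apolar_locus_0:
  fixes q :: "'a::field_char_0 poly poly"
  assumes "q \<in> apolar_locus d 0"
  shows "q = 0"
proof -
  obtain g where g: "g \<noteq> 0" "apolar d q 0 g" "q \<in> forms d"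
    using assms by (auto simp: apolar_locus_def)
  then obtain c where c: "g = [:c:]" "c \<noteq> 0"
    by (auto simp: apolar_def elim: degree_eq_zeroE)
  show ?thesis
  proof (rule pairing_eq_0_imp[OF g(3)])
    show "pairing d q p = 0" if "degree p \<le> d" for p
      using g(2) c that by (auto simp: apolar_def pairing_smult)
  qed
qed

text \<open>
  The product of the linear factors vanishing at the points is apolar. A zero summand
  contributes the factor \<open>1\<close>, which keeps the product nonzero.
\<close>

lemma power_sum_in_apolar_locus:
  fixes q :: "'a::field_char_0 poly poly"
  assumes "power_sum d s q"
  shows "q \<in> apolar_locus d s"
proof -
  obtain P where q: "q = (\<Sum>i<s. lin_form (P i) ^ d)" using assms by (auto simp: power_sum_def)
  define f where "f i = (if P i = (0, 0) then 1 else root_at (P i))" for i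
  define g where "g = (\<Prod>i<s. f i)"
  have deg: "degree (f i) \<le> 1" for i using degree_root_at[of "P i"] by (simp add: f_def)
  note prod = hval_prod[of "{..<s}" f, OF finite_lessThan deg]
  have "f i \<noteq> 0" for i by (auto simp: f_def root_at_def prod_eq_iff)
  then have "g \<noteq> 0" by (simp add: g_def)
  have zero: "hval s (P i) g = 0" if "i < s" for i
  proof -
    have "hval 1 (P i) (f i) = 0"
      by (auto simp: f_def hval_def root_at_def)
    then have "(\<Prod>k<s. hval 1 (P i) (f k)) = 0" using that by auto
    then show ?thesis using prod[of "P i"] by (simp add: g_def)
  qed
  have "apolar d q s g"
    unfolding apolar_def
  proof (intro conjI allI impI)
    show "degree g \<le> s" using prod by (simp add: g_def)
    fix h :: "'a poly" assume h: "degree h + s \<le> d"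
    have "hval d (P i) (h * g) = 0" if "i < s" for i
      using hval_mult[of h "d - s" g s "P i"] \<open>degree g \<le> s\<close> h zero[OF that] by simp
    then show "pairing d q (h * g) = 0" by (simp add: q pairing_sum_left pairing_lin_form_power)
  qed
  then show ?thesis using \<open>g \<noteq> 0\<close> power_sum_in_forms[OF assms] by (auto simp: apolar_locus_def)
qed

text \<open>
  This is the lower bound for the rank: short representations are confined to the zeros of any
  apolar form.
\<close>

lemma general_position_length_le:
  fixes P :: "nat \<Rightarrow> 'a::field_char_0 \<times> 'a"
  assumes "general_position s P" "(\<Sum>i<s. lin_form (P i) ^ d) \<in> apolar_locus d r" "s + r \<le> d + 1"
  shows "s \<le> r"
proof -
  obtain g where g: "g \<noteq> 0" "apolar d (\<Sum>i<s. lin_form (P i) ^ d) r g"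
    using assms(2) by (auto simp: apolar_locus_def)
  show ?thesis
    using general_position_zeros_le[OF assms(1) g(1)] apolar_vanishes_at_points[OF g(2) assms(1,3)] g(2)
    by (simp add: apolar_def)
qed

text \<open>
  A polynomial of degree at most \<open>d\<close> that vanishes at all roots of \<open>g\<close> is a multiple of \<open>g\<close>, hence is
  killed by \<open>q\<close>. By duality \<open>q\<close> is a combination of the evaluations at the roots, which are the
  functionals of powers of linear forms.
\<close>

lemma power_sum_of_distinct_roots:
  fixes g :: "'a::{alg_closed_field,field_char_0} poly"
  assumes q: "q \<in> forms d" and "d \<ge> 1" and g: "apolar d q s g"
    and deg: "degree g = s" and card: "card {x. poly g x = 0} = s" and "g \<noteq> 0"
  shows "power_sum d s q"
proof -
  obtain t where t: "bij_betw t {..<s} {x. poly g x = 0}"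
    using ex_bij_betw_nat_finite[OF poly_roots_finite[OF \<open>g \<noteq> 0\<close>]] card by (auto simp: atLeast0LessThan)
  have "\<exists>c. \<forall>p\<in>{p. degree p \<le> d}. pairing d q p = (\<Sum>i<s. c i * poly p (t i))"
  proof (rule functional_in_span[OF poly_subspace_degree_le linear_functional_poly linear_functional_pairing])
    fix p assume p: "p \<in> {p. degree p \<le> d}" and zeros: "\<And>i. i < s \<Longrightarrow> poly p (t i) = 0"
    have "poly p x = 0" if "poly g x = 0" for x
    proof -
      have "x \<in> t ` {..<s}" using that t by (simp add: bij_betw_def)
      then show ?thesis using zeros by auto
    qed
    then have "{x. poly g x = 0} \<subseteq> {x. poly (p mod g) x = 0}"
      by (auto simp: minus_div_mult_eq_mod[symmetric])
    then have "p mod g = 0"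
      using card_poly_roots_bound[of "p mod g"] poly_roots_finite[of "p mod g"] card deg
        degree_mod_less'[OF \<open>g \<noteq> 0\<close>, of p]
      by (metis (no_types, lifting) card_mono leD le_trans)
    then obtain h where h: "p = h * g" by (metis dvd_def mod_0_imp_dvd mult.commute)
    show "pairing d q p = 0"
    proof (cases "h = 0")
      case False
      then have "degree h + s \<le> d" using p h deg \<open>g \<noteq> 0\<close> by (simp add: degree_mult_eq)
      then show ?thesis using g h by (simp add: apolar_def)
    qed (simp add: h)
  qed
  then obtain c where c: "\<And>p. degree p \<le> d \<Longrightarrow> pairing d q p = (\<Sum>i<s. c i * poly p (t i))" by auto
  have "q = (\<Sum>i<s. scale_form (c i) (lin_form (1, t i) ^ d))"
  proof (rule forms_eqI[OF q])
    show "(\<Sum>i<s. scale_form (c i) (lin_form (1, t i) ^ d)) \<in> forms d"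
      by (intro forms_sum forms_scale lin_form_power_in_forms)
    fix k assume "k \<le> d"
    then show "dual_coeff d q k = dual_coeff d (\<Sum>i<s. scale_form (c i) (lin_form (1, t i) ^ d)) k"
      using c[of "monom 1 k"]
      by (simp add: pairing_monom degree_monom_eq dual_coeff_sum dual_coeff_scale
          dual_coeff_lin_form_power poly_monom)
  qed
  then show ?thesis
    using power_sumI[OF \<open>d \<ge> 1\<close>, of "{..<s}" s q c "\<lambda>i. (1, t i)"] by simp
qed

lemma apolar_subspace: "poly_subspace {p. apolar d q s p}"
  by (auto simp: poly_subspace_def apolar_def pairing_add pairing_smult distrib_left
      intro!: degree_add_le order_trans[OF degree_smult_le])

lemma linear_functional_hval: "linear_functional (hval n P)"
  by (simp add: linear_functional_def hval_def algebra_simps sum.distrib sum_distrib_left)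

text \<open>
  If all apolar forms of degree \<open>s = d + 2 - r\<close> vanish at \<open>P\<close>, then evaluation at \<open>P\<close> is, by duality,
  a combination of the equations of apolarity, that is, the pairing of \<open>q\<close> with the product of
  the argument and some \<open>w\<close> of degree at most \<open>r - 2\<close>. Then \<open>w\<close> times the linear form vanishing at \<open>P\<close> is apolar of degree
  \<open>r - 1\<close>. For \<open>r = 1\<close> there are no equations and \<open>w = 0\<close>.
\<close>

lemma apolar_base_point_free:
  fixes q :: "'a::field_char_0 poly poly"
  assumes q: "q \<in> forms d" and r: "1 \<le> r" "r \<le> d + 1" "q \<notin> apolar_locus d (r - 1)"
    and P: "P \<noteq> (0, 0)"
  shows "\<exists>f. apolar d q (d + 2 - r) f \<and> hval (d + 2 - r) P f \<noteq> 0"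
proof (rule ccontr)
  define s where "s = d + 2 - r"
  assume "\<nexists>f. apolar d q (d + 2 - r) f \<and> hval (d + 2 - r) P f \<noteq> 0"
  then have none: "hval s P f = 0" if "apolar d q s f" for f using that by (auto simp: s_def)
  have "\<exists>c. \<forall>p\<in>{p. degree p \<le> s}. hval s P p = (\<Sum>i<r-1. c i * pairing d q (monom 1 i * p))"
  proof (rule functional_in_span[OF poly_subspace_degree_le _ linear_functional_hval])
    show "linear_functional (\<lambda>p. pairing d q (monom 1 i * p))" for i
      by (simp add: linear_functional_def pairing_add pairing_smult distrib_left)
    show "hval s P p = 0" if "p \<in> {p. degree p \<le> s}"
      and "\<And>i. i < r - 1 \<Longrightarrow> pairing d q (monom 1 i * p) = 0" for p
      using that r(1,2) by (intro none apolarI_monom) (auto simp: s_def)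
  qed
  then obtain c where c: "\<And>p. degree p \<le> s \<Longrightarrow>
      hval s P p = (\<Sum>i<r-1. c i * pairing d q (monom 1 i * p))" by auto
  define w where "w = (\<Sum>i<r-1. monom (c i) i)"
  have val: "hval s P p = pairing d q (w * p)" if "degree p \<le> s" for p
  proof -
    have "monom (c i) i * p = smult (c i) (monom 1 i * p)" for i
      by (simp add: smult_monom flip: mult_smult_left)
    then show ?thesis by (simp add: c[OF that] w_def sum_distrib_right pairing_sum pairing_smult)
  qed
  have w_deg: "degree (w * root_at P) \<le> r - 1"
  proof (cases "r = 1")
    case True
    then show ?thesis by (simp add: w_def)
  next
    case False
    have "degree w \<le> r - 2"
      unfolding w_def by (intro degree_sum_le) (auto intro!: order_trans[OF degree_monom_le])
    then show ?thesis
      using degree_mult_le[of w "root_at P"] degree_root_at[of P] False r(1) by linarith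
  qed
  have "apolar d q (r - 1) (w * root_at P)"
    unfolding apolar_def
  proof (intro conjI allI impI w_deg)
    fix h :: "'a poly" assume h: "degree h + (r - 1) \<le> d"
    then have s: "degree h \<le> s - 1" "1 + (s - 1) = s" using r by (auto simp: s_def)
    have "degree (root_at P * h) \<le> s"
      using degree_mult_le[of "root_at P" h] degree_root_at[of P] s by linarith
    then have "pairing d q (w * (root_at P * h)) = hval s P (root_at P * h)" using val by simp
    also have "\<dots> = hval 1 P (root_at P) * hval (s - 1) P h"
      using hval_mult[OF degree_root_at s(1), of P P] s(2) by simp
    also have "\<dots> = 0" by (simp only: hval_root_at) (simp add: cross_def)
    finally show "pairing d q (h * (w * root_at P)) = 0" by (simp add: mult_ac)
  qed
  then have "w * root_at P = 0" using r(3) q unfolding apolar_locus_def by blast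
  moreover have "root_at P \<noteq> 0" using P by (auto simp: root_at_def prod_eq_iff)
  ultimately have "w = 0" by simp
  then have "hval s P 1 = 0" "hval s P (monom 1 s) = 0"
    using val[of 1] val[of "monom 1 s"] by (simp_all add: degree_monom_le)
  then show False
    using P hval_infinite_point[of P s "monom 1 s"] hval_finite_point[of P 1 s]
    by (cases "fst P = 0") (auto simp: prod_eq_iff)
qed

text \<open>
  The point at infinity yields an apolar \<open>f\<close> of full degree, and avoiding the roots of \<open>f\<close> yields an
  apolar \<open>g\<close> without common zeros with \<open>f\<close>; a general member of their pencil has distinct roots.
\<close>

lemma power_sum_complementary:
  fixes q :: "'a::{alg_closed_field,field_char_0} poly poly"
  assumes q: "q \<in> forms d" and d: "d \<ge> 1" and r: "1 \<le> r" "r \<le> d + 1" "q \<notin> apolar_locus d (r - 1)"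
  shows "power_sum d (d + 2 - r) q"
proof -
  define s where "s = d + 2 - r"
  define V where "V = {p. apolar d q s p}"
  note free = apolar_base_point_free[OF q r, folded s_def]
  have "s \<ge> 1" using r by (simp add: s_def)
  obtain f where f: "f \<in> V" "hval s (0, 1) f \<noteq> 0" using free[of "(0, 1)"] by (auto simp: V_def)
  then have "coeff f s \<noteq> 0" by (simp add: hval_infinite_point)
  then have deg: "degree f = s" "f \<noteq> 0"
    using f(1) by (auto simp: V_def apolar_def intro!: antisym le_degree)
  have "\<exists>g\<in>V. \<forall>t\<in>{x. poly f x = 0}. poly g t \<noteq> 0"
  proof (rule exists_avoiding_points)
    show "poly_subspace V" unfolding V_def by (rule apolar_subspace)
    show "finite {x. poly f x = 0}" using deg poly_roots_finite by blast
    show "\<exists>g\<in>V. poly g t \<noteq> 0" for t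
      using free[of "(1, t)"] hval_finite_point[of "(1, t)" _ s] by (auto simp: V_def apolar_def)
  qed
  then obtain g where g: "g \<in> V" "\<And>x. poly f x = 0 \<Longrightarrow> poly g x \<noteq> 0" by blast
  have "finite {t. \<not> (degree (g + smult t f) = s \<and> card {x. poly (g + smult t f) x = 0} = s)}"
    using g deg \<open>s \<ge> 1\<close> by (intro finite_degenerate_pencil_members) (auto simp: V_def apolar_def)
  then obtain t where t: "degree (g + smult t f) = s" "card {x. poly (g + smult t f) x = 0} = s"
    using ex_new_if_finite infinite_UNIV_char_0 by blast
  have "g + smult t f \<in> V"
    using apolar_subspace[of d q s] g f by (auto simp: V_def poly_subspace_def)
  then have "power_sum d s q"
    using t \<open>s \<ge> 1\<close> by (intro power_sum_of_distinct_roots[OF q d]) (auto simp: V_def)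
  then show ?thesis by (simp add: s_def)
qed

text \<open>
  The hypotheses say that \<open>r\<close> is the least degree of a nonzero apolar form. Between \<open>r\<close> and
  \<open>d + 2 - r\<close> no rank is possible because of the lower bound.
\<close>

lemma sylvester_rank:
  fixes q :: "'a::{alg_closed_field,field_char_0} poly poly"
  assumes d: "d \<ge> 1" and r: "1 \<le> r" "r \<le> d + 1"
    and q: "q \<in> apolar_locus d r" "q \<notin> apolar_locus d (r - 1)"
  shows "form_rank d q = r \<or> form_rank d q = d + 2 - r"
proof -
  define \<rho> where "\<rho> = form_rank d q"
  have forms: "q \<in> forms d" using q by (simp add: apolar_locus_def)
  note upper = power_sum_complementary[OF forms d r q(2)]
  have \<rho>: "1 \<le> \<rho>" "power_sum d \<rho> q" using form_rank_properties[OF upper d] by (simp_all add: \<rho>_def)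
  have "\<rho> \<le> d + 2 - r" unfolding \<rho>_def using r by (intro form_rank_le upper) simp
  have "r \<le> \<rho>"
  proof (rule ccontr)
    assume "\<not> r \<le> \<rho>"
    then have "apolar_locus d \<rho> \<subseteq> (apolar_locus d (r - 1) :: 'a poly poly set)"
      by (intro apolar_locus_mono) simp
    then show False using power_sum_in_apolar_locus[OF \<rho>(2)] q(2) by blast
  qed
  obtain s P where s: "s \<le> \<rho>" "general_position s P" and sum: "q = (\<Sum>i<s. lin_form (P i) ^ d)"
    using power_sum_general_position[OF \<rho>(2) d] by blast
  have "\<rho> \<le> s"
  proof (cases "s = 0")
    case True
    then have "q = 0" using sum by simp
    then show ?thesis using q(2) zero_in_apolar_locus by blast
  next
    case False
    then show ?thesis unfolding \<rho>_def using sum by (intro form_rank_le) (auto simp: power_sum_def)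
  qed
  then have "\<rho> + r \<le> d + 1 \<Longrightarrow> \<rho> \<le> r"
    using general_position_length_le[OF s(2), of d r] q(1) s(1) sum by simp
  then show ?thesis using \<open>r \<le> \<rho>\<close> \<open>\<rho> \<le> d + 2 - r\<close> unfolding \<rho>_def by linarith
qed

section \<open>The apolarity loci are Zariski closed\<close>

lemma form_polyfuns_sum:
  "(\<And>i. i \<in> I \<Longrightarrow> f i \<in> form_polyfuns d) \<Longrightarrow> (\<lambda>q. \<Sum>i\<in>I. f i q) \<in> form_polyfuns d"
  by (induction I rule: infinite_finite_induct) (simp_all add: form_polyfuns.const form_polyfuns.add)

lemma form_polyfuns_prod:
  "(\<And>i. i \<in> I \<Longrightarrow> f i \<in> form_polyfuns d) \<Longrightarrow> (\<lambda>q. \<Prod>i\<in>I. f i q) \<in> form_polyfuns d"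
  by (induction I rule: infinite_finite_induct) (simp_all add: form_polyfuns.const form_polyfuns.mult)

lemma pairing_polyfun: "(\<lambda>q. pairing d q p) \<in> form_polyfuns d"
proof -
  have "(\<lambda>q. dual_coeff d q i) \<in> form_polyfuns d" if "i \<le> d" for i
    unfolding dual_coeff_def divide_inverse
    using that by (intro form_polyfuns.mult form_polyfuns.coord form_polyfuns.const) simp
  then show ?thesis
    unfolding pairing_def
    by (intro form_polyfuns_sum form_polyfuns.mult form_polyfuns.const) simp
qed

lemma det_polyfun:
  assumes "\<And>i j. i < n \<Longrightarrow> j < n \<Longrightarrow> (\<lambda>q. N q i j) \<in> form_polyfuns d"
  shows "(\<lambda>q. det (mat n n (\<lambda>(i, j). N q i j))) \<in> form_polyfuns d"
proof -
  have "det (mat n n (\<lambda>(i, j). N q i j)) =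
      (\<Sum>p\<in>{p. p permutes {0..<n}}. signof p * (\<Prod>i\<in>{0..<n}. N q i (p i)))" for q
  proof -
    have "(\<Prod>i = 0..<n. mat n n (\<lambda>(i, j). N q i j) $$ (i, p i)) = (\<Prod>i\<in>{0..<n}. N q i (p i))"
      if "p permutes {0..<n}" for p
      using permutes_in_image[OF that] by (intro prod.cong refl) simp
    then show ?thesis by (subst det_def'[of _ n]) simp_all
  qed
  then show ?thesis
    by (simp only:)
       (intro form_polyfuns_sum form_polyfuns.mult form_polyfuns.const form_polyfuns_prod assms,
        auto simp: permutes_in_image)
qed

text \<open>
  For \<open>q\<close> outside the locus the catalecticant matrix has trivial kernel, hence a left inverse
  \<open>B\<close>. Multiplying the catalecticant of a variable form \<open>q'\<close> by this fixed \<open>B\<close> and taking the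
  determinant gives a polynomial function that is \<open>1\<close> at \<open>q\<close>, and that vanishes wherever the
  catalecticant has a kernel.
\<close>

lemma apolar_locus_separated:
  fixes q :: "'a::field_char_0 poly poly"
  assumes q: "q \<in> forms d" "q \<notin> apolar_locus d r"
  shows "\<exists>f\<in>form_polyfuns d. f q \<noteq> 0 \<and> (\<forall>q'\<in>apolar_locus d r. f q' = 0)"
proof -
  define n where "n = d + 1 - r"
  have "\<exists>B. \<forall>p\<in>{p. degree p \<le> r}. coeff p j = (\<Sum>i<n. B i * pairing d q (monom 1 i * p))" for j
  proof (rule functional_in_span[OF poly_subspace_degree_le _ linear_functional_coeff])
    show "linear_functional (\<lambda>p. pairing d q (monom 1 i * p))" for i
      by (simp add: linear_functional_def pairing_add pairing_smult distrib_left)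
    fix p assume "p \<in> {p. degree p \<le> r}" "\<And>i. i < n \<Longrightarrow> pairing d q (monom 1 i * p) = 0"
    then have "apolar d q r p" by (intro apolarI_monom) (auto simp: n_def)
    then have "p = 0" using q unfolding apolar_locus_def by blast
    then show "coeff p j = 0" by simp
  qed
  then have "\<forall>j. \<exists>B. \<forall>p\<in>{p. degree p \<le> r}. coeff p j = (\<Sum>i<n. B i * pairing d q (monom 1 i * p))"
    by blast
  from choice[OF this] obtain B where B: "\<And>j p. degree p \<le> r \<Longrightarrow>
      coeff p j = (\<Sum>i<n. B j i * pairing d q (monom 1 i * p))" by auto
  \<comment> \<open>the entries of \<open>B\<close> times the catalecticant matrix of \<open>q'\<close>\<close>
  define N where "N q' j m = (\<Sum>i<n. B j i * pairing d q' (monom 1 i * monom 1 m))" for q' j m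
  define f where "f q' = det (mat (r + 1) (r + 1) (\<lambda>(j, m). N q' j m))" for q'
  have "f \<in> form_polyfuns d"
    unfolding f_def N_def
    by (intro det_polyfun form_polyfuns_sum form_polyfuns.mult form_polyfuns.const pairing_polyfun)
  moreover have "f q = 1"
  proof -
    have "mat (r + 1) (r + 1) (\<lambda>(j, m). N q j m) = 1\<^sub>m (r + 1)"
      unfolding N_def by (intro eq_matI) (auto simp: B[symmetric] degree_monom_le order_trans[OF degree_monom_le])
    then show ?thesis by (simp add: f_def)
  qed
  moreover have "f q' = 0" if "q' \<in> apolar_locus d r" for q'
  proof -
    have "\<exists>g. g \<noteq> 0 \<and> apolar d q' r g" using that by (simp add: apolar_locus_def)
    then obtain g where g: "g \<noteq> 0" "apolar d q' r g" by blast
    define v where "v = vec (r + 1) (coeff g)"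
    have deg: "degree g \<le> r" using g by (simp add: apolar_def)
    have "coeff g (degree g) \<noteq> 0" using g by simp
    then have v: "v \<in> carrier_vec (r + 1)" "v \<noteq> 0\<^sub>v (r + 1)"
      using deg by (auto simp: v_def vec_eq_iff intro!: exI[of _ "degree g"])
    have "(\<Sum>m<r + 1. N q' j m * coeff g m) = 0" for j
    proof -
      have "monom 1 i * g = (\<Sum>m<r + 1. smult (coeff g m) (monom 1 i * monom 1 m))" for i
      proof -
        have "g = (\<Sum>m<r + 1. monom (coeff g m) m)"
          using poly_as_sum_of_monoms'[OF deg] by (simp add: lessThan_Suc_atMost)
        then have "monom 1 i * g = (\<Sum>m<r + 1. monom 1 i * monom (coeff g m) m)"
          by (metis sum_distrib_left)
        then show ?thesis by (simp add: mult_monom smult_monom)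
      qed
      then have "pairing d q' (monom 1 i * g) = (\<Sum>m<r + 1. coeff g m * pairing d q' (monom 1 i * monom 1 m))" for i
        by (simp only: pairing_sum pairing_smult)
      moreover have "pairing d q' (monom 1 i * g) = 0" if "i < n" for i
        using g that by (auto simp: apolar_def n_def degree_monom_eq)
      ultimately have "(\<Sum>i<n. B j i * (\<Sum>m<r + 1. coeff g m * pairing d q' (monom 1 i * monom 1 m))) = 0"
        by (intro sum.neutral) auto
      then show ?thesis
        unfolding N_def sum_distrib_right sum_distrib_left
        by (subst sum.swap) (simp add: mult_ac)
    qed
    then have "mat (r + 1) (r + 1) (\<lambda>(j, m). N q' j m) *\<^sub>v v = 0\<^sub>v (r + 1)"
      by (intro eq_vecI) (simp_all add: v_def scalar_prod_def atLeast0LessThan)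
    then show ?thesis
      unfolding f_def using v by (subst det_0_iff_vec_prod_zero_field[of _ "r + 1"]) auto
  qed
  ultimately show ?thesis by (metis zero_neq_one)
qed

lemma apolar_locus_closed: "zariski_closed d (apolar_locus d r :: 'a::field_char_0 poly poly set)"
proof -
  define F where "F = {f \<in> form_polyfuns d. \<forall>q\<in>apolar_locus d r. f q = (0::'a)}"
  have "apolar_locus d r = {q \<in> forms d. \<forall>f\<in>F. f q = 0}"
  proof (intro equalityI subsetI)
    fix q :: "'a poly poly" assume "q \<in> apolar_locus d r"
    then show "q \<in> {q \<in> forms d. \<forall>f\<in>F. f q = 0}" by (simp add: F_def) (simp add: apolar_locus_def)
  next
    fix q :: "'a poly poly" assume q: "q \<in> {q \<in> forms d. \<forall>f\<in>F. f q = 0}"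
    show "q \<in> apolar_locus d r"
    proof (rule ccontr)
      assume "q \<notin> apolar_locus d r"
      then obtain f where "f \<in> F" "f q \<noteq> 0"
        using apolar_locus_separated[of q d r] q by (auto simp: F_def)
      then show False using q by blast
    qed
  qed
  moreover have "F \<subseteq> form_polyfuns d" by (auto simp: F_def)
  ultimately show ?thesis unfolding zariski_closed_def by blast
qed

text \<open>
  Apolarity imposes \<open>d - r + 1 \<le> r\<close> linear equations on \<open>r + 1\<close> coefficients. Padded with zero
  rows, the catalecticant is a singular square matrix.
\<close>

lemma apolar_locus_full:
  fixes q :: "'a::field_char_0 poly poly"
  assumes "q \<in> forms d" "d < 2 * r"
  shows "q \<in> apolar_locus d r"
proof -
  define A where "A = mat (r + 1) (r + 1)
    (\<lambda>(i, j). if i + r \<le> d then pairing d q (monom 1 i * monom 1 j) else 0)"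
  have A: "A \<in> carrier_mat (r + 1) (r + 1)" by (simp add: A_def)
  have "transpose_mat A *\<^sub>v unit_vec (r + 1) r = 0\<^sub>v (r + 1)"
    using assms(2) by (intro eq_vecI) (auto simp: A_def)
  moreover have "unit_vec (r + 1) r \<noteq> (0\<^sub>v (r + 1) :: 'a vec)" by simp
  moreover have "transpose_mat A \<in> carrier_mat (r + 1) (r + 1)" using A by simp
  ultimately have "det (transpose_mat A) = 0"
    using det_0_iff_vec_prod_zero_field unit_vec_carrier by blast
  then have "det A = 0" using det_transpose[OF A] by simp
  then obtain v where v: "v \<in> carrier_vec (r + 1)" "v \<noteq> 0\<^sub>v (r + 1)" "A *\<^sub>v v = 0\<^sub>v (r + 1)"
    using det_0_iff_vec_prod_zero_field[OF A] by blast
  define g where "g = (\<Sum>j<r + 1. monom (v $ j) j)"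
  have coeff: "coeff g j = (if j < r + 1 then v $ j else 0)" for j
    unfolding g_def coeff_sum by simp
  obtain j where "j < r + 1" "v $ j \<noteq> 0" using v(1,2) by (auto simp: vec_eq_iff)
  then have "coeff g j \<noteq> 0" by (simp add: coeff)
  then have "g \<noteq> 0" by auto
  moreover have "apolar d q r g"
  proof (rule apolarI_monom)
    show "degree g \<le> r" by (rule degree_le) (simp add: coeff)
    fix i assume i: "i + r \<le> d"
    then have "i < r + 1" using assms(2) by simp
    have "pairing d q (monom 1 i * g) = (\<Sum>j<r + 1. pairing d q (smult (v $ j) (monom 1 i * monom 1 j)))"
      by (simp add: g_def sum_distrib_left pairing_sum mult_monom smult_monom del: sum.lessThan_Suc)
    also have "\<dots> = (A *\<^sub>v v) $ i"
      using i v(1) \<open>i < r + 1\<close>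
      by (simp add: A_def scalar_prod_def pairing_smult atLeast0LessThan mult.commute)
    also have "\<dots> = 0" using v(3) \<open>i < r + 1\<close> by simp
    finally show "pairing d q (monom 1 i * g) = 0" .
  qed
  ultimately show ?thesis using assms(1) by (auto simp: apolar_locus_def)
qed

lemma apolar_degree_exists:
  fixes q :: "'a::field_char_0 poly poly"
  assumes "q \<in> forms d" "q \<noteq> 0"
  obtains r where "1 \<le> r" "r \<le> d div 2 + 1" "q \<in> apolar_locus d r" "q \<notin> apolar_locus d (r - 1)"
proof -
  define r where "r = (LEAST r. q \<in> apolar_locus d r)"
  have full: "q \<in> apolar_locus d (d div 2 + 1)" using assms by (intro apolar_locus_full) auto
  have "q \<in> apolar_locus d r" unfolding r_def by (rule LeastI[of _ "d div 2 + 1"]) fact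
  moreover have "1 \<le> r" using \<open>q \<in> apolar_locus d r\<close> apolar_locus_0 assms(2) by (cases r) auto
  moreover have "q \<notin> apolar_locus d (r - 1)"
    using not_less_Least[of "r - 1" "\<lambda>r. q \<in> apolar_locus d r"] \<open>1 \<le> r\<close> by (auto simp: r_def)
  moreover have "r \<le> d div 2 + 1" unfolding r_def by (rule Least_le) fact
  ultimately show ?thesis using that by blast
qed

lemma power_sum_exists:
  fixes q :: "'a::{alg_closed_field,field_char_0} poly poly"
  assumes "q \<in> forms d" "d \<ge> 1"
  shows "\<exists>r. power_sum d r q"
proof (cases "q = 0")
  case True
  then have "power_sum d 0 q" by (simp add: power_sum_def)
  then show ?thesis ..
next
  case False
  then obtain r where "1 \<le> r" "r \<le> d div 2 + 1" "q \<notin> apolar_locus d (r - 1)"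
    using apolar_degree_exists[OF assms(1)] by metis
  then have "power_sum d (d + 2 - r) q" by (intro power_sum_complementary assms) auto
  then show ?thesis ..
qed

section \<open>Curves of forms\<close>

lemma polyfun_along_curve:
  assumes "f \<in> form_polyfuns d"
  shows "\<exists>F. \<forall>t. f (form_of d (\<lambda>i. poly (c i) t)) = poly F t"
  using assms
proof induction
  case (const a)
  show ?case by (intro exI[of _ "[:a:]"]) simp
next
  case (coord i j)
  then show ?case by (intro exI[of _ "smult (of_nat (d choose j)) (c j)"]) (simp add: coeff_form_of)
next
  case (add f g)
  then show ?case by (metis poly_add)
next
  case (mult f g)
  then show ?case by (metis poly_mult)
qed

text \<open>
  A polynomial function restricted to a polynomial curve is a polynomial in the parameter. So
  a polynomial function that vanishes at almost all points of the curve vanishes at every point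
  of it.
\<close>

lemma polyfun_vanishes_at_limit:
  fixes c :: "nat \<Rightarrow> 'a::field_char_0 poly"
  assumes f: "f \<in> form_polyfuns d" and "finite T"
    and "\<And>t. t \<notin> T \<Longrightarrow> f (form_of d (\<lambda>i. poly (c i) t)) = 0"
  shows "f (form_of d (\<lambda>i. poly (c i) t)) = 0"
proof -
  obtain F where F: "\<And>t. f (form_of d (\<lambda>i. poly (c i) t)) = poly F t"
    using polyfun_along_curve[OF f, of c] by metis
  have "F = 0"
  proof (rule ccontr)
    assume "F \<noteq> 0"
    then have "finite ({t. poly F t = 0} \<union> T)" using poly_roots_finite assms(2) by blast
    moreover have "{t. poly F t = 0} \<union> T = UNIV" using assms(3) F by auto
    ultimately show False using infinite_UNIV_char_0 by metis
  qed
  then show ?thesis using F by simp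
qed

text \<open>
  New points of the form \<open>(1, m)\<close> only have to avoid finitely many slopes.
\<close>

lemma extend_general_position:
  fixes P :: "nat \<Rightarrow> 'a::field_char_0 \<times> 'a"
  assumes "general_position s P" "s \<le> r"
  shows "\<exists>Q. general_position r Q \<and> (\<forall>i<s. Q i = P i)"
  using assms(2)
proof (induction rule: dec_induct)
  case base
  then show ?case using assms(1) by blast
next
  case (step n)
  then obtain Q where Q: "general_position n Q" "\<forall>i<s. Q i = P i" by blast
  have "finite ((\<lambda>i. snd (Q i) / fst (Q i)) ` {..<n})" by simp
  then obtain m where m: "m \<notin> (\<lambda>i. snd (Q i) / fst (Q i)) ` {..<n}"
    using ex_new_if_finite infinite_UNIV_char_0 by blast
  have new: "cross (Q i) (1, m) \<noteq> 0" if "i < n" for i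
  proof
    assume cr: "cross (Q i) (1, m) = 0"
    then have "snd (Q i) = fst (Q i) * m" by (simp add: cross_def)
    moreover have "Q i \<noteq> (0, 0)" using Q(1) that by (simp add: general_position_def)
    ultimately have "m = snd (Q i) / fst (Q i)" by (auto simp: prod_eq_iff)
    then show False using m that by blast
  qed
  have anti: "cross x y = - cross y x" for x y :: "'a \<times> 'a" by (simp add: cross_def)
  have "cross (1, m) (Q i) \<noteq> 0" if "i < n" for i
    using new[OF that] anti[of "(1, m)" "Q i"] by simp
  then have "general_position (Suc n) (Q(n := (1, m)))"
    using Q(1) new by (auto simp: general_position_def less_Suc_eq)
  moreover have "\<forall>i<s. (Q(n := (1, m))) i = P i" using Q(2) step by auto
  ultimately show ?case by blast
qed

text \<open>
  A shorter representation would yield an apolar form of degree less than \<open>r\<close>, contradicting the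
  lower bound since the lengths add up to at most \<open>d + 1\<close>.
\<close>

lemma form_rank_general_position:
  fixes P :: "nat \<Rightarrow> 'a::{alg_closed_field,field_char_0} \<times> 'a"
  assumes gp: "general_position r P" and "1 \<le> r" "2 * r \<le> d + 2" "d \<ge> 1"
  shows "form_rank d (\<Sum>i<r. lin_form (P i) ^ d) = r"
proof -
  let ?q = "\<Sum>i<r. lin_form (P i) ^ d"
  have sum: "power_sum d r ?q" by (auto simp: power_sum_def)
  have "form_rank d ?q \<le> r" by (rule form_rank_le[OF sum assms(2)])
  moreover have "?q \<in> apolar_locus d (form_rank d ?q)"
    by (rule power_sum_in_apolar_locus[OF form_rank_properties(2)[OF sum assms(4)]])
  then have "r + form_rank d ?q \<le> d + 1 \<Longrightarrow> r \<le> form_rank d ?q"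
    using general_position_length_le[OF gp] by blast
  ultimately show ?thesis using assms(3) by linarith
qed

text \<open>
  A sum of \<open>s \<le> r\<close> powers is the limit for \<open>t \<rightarrow> 0\<close> of itself plus \<open>t\<^sup>d\<close> times \<open>r - s\<close> further
  powers in general position, and these sums have rank \<open>r\<close> for \<open>t \<noteq> 0\<close>.
\<close>

lemma polyfun_vanishes_on_power_sums:
  fixes q :: "'a::{alg_closed_field,field_char_0} poly poly"
  assumes f: "f \<in> form_polyfuns d" and vanish: "\<And>q. q \<in> rank_locus d r \<Longrightarrow> f q = 0"
    and d: "d \<ge> 1" and r: "1 \<le> r" "2 * r \<le> d + 2" and q: "power_sum d r q"
  shows "f q = 0"
proof -
  obtain s P where s: "s \<le> r" and P: "general_position s P" "q = (\<Sum>i<s. lin_form (P i) ^ d)"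
    using power_sum_general_position[OF q d] by blast
  obtain Q where Q: "general_position r Q" "\<And>i. i < s \<Longrightarrow> Q i = P i"
    using extend_general_position[OF P(1) s] by blast
  define R where "R t i = (if i < s then Q i else (t * fst (Q i), t * snd (Q i)))" for t i
  define c where "c k = [:\<Sum>i<s. fst (Q i) ^ (d - k) * snd (Q i) ^ k:]
    + monom (\<Sum>i\<in>{s..<r}. fst (Q i) ^ (d - k) * snd (Q i) ^ k) d" for k
  have split: "{..<r} = {..<s} \<union> {s..<r}" using s by auto
  have curve: "form_of d (\<lambda>k. poly (c k) t) = (\<Sum>i<r. lin_form (R t i) ^ d)" for t
  proof (rule forms_eqI[OF form_of_in_forms])
    show "(\<Sum>i<r. lin_form (R t i) ^ d) \<in> forms d"
      by (intro forms_sum lin_form_power_in_forms)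
    fix k assume k: "k \<le> d"
    have scaled: "(t * x) ^ (d - k) * (t * y) ^ k = x ^ (d - k) * y ^ k * t ^ d" for x y
    proof -
      have "t ^ d = t ^ (d - k) * t ^ k" using k by (simp flip: power_add)
      then show ?thesis by (simp only: power_mult_distrib mult_ac)
    qed
    have "dual_coeff d (\<Sum>i<r. lin_form (R t i) ^ d) k = (\<Sum>i<r. fst (R t i) ^ (d - k) * snd (R t i) ^ k)"
      using k by (simp add: dual_coeff_sum dual_coeff_lin_form_power)
    also have "\<dots> = (\<Sum>i<s. fst (R t i) ^ (d - k) * snd (R t i) ^ k)
        + (\<Sum>i\<in>{s..<r}. fst (R t i) ^ (d - k) * snd (R t i) ^ k)"
      unfolding split by (rule sum.union_disjoint) auto
    also have "\<dots> = (\<Sum>i<s. fst (Q i) ^ (d - k) * snd (Q i) ^ k)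
        + (\<Sum>i\<in>{s..<r}. fst (Q i) ^ (d - k) * snd (Q i) ^ k * t ^ d)"
      by (intro arg_cong2[of _ _ _ _ "(+)"] sum.cong)
         (simp_all add: R_def scaled)
    also have "\<dots> = poly (c k) t"
      by (simp add: c_def poly_monom flip: sum_distrib_right)
    finally have "dual_coeff d (\<Sum>i<r. lin_form (R t i) ^ d) k = poly (c k) t" .
    moreover have "dual_coeff d (form_of d (\<lambda>k. poly (c k) t)) k = poly (c k) t"
      using k by (rule dual_coeff_form_of)
    ultimately show "dual_coeff d (form_of d (\<lambda>k. poly (c k) t)) k =
        dual_coeff d (\<Sum>i<r. lin_form (R t i) ^ d) k" by (simp only:)
  qed
  have generic: "f (form_of d (\<lambda>k. poly (c k) t)) = 0" if "t \<notin> {0}" for t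
  proof -
    have "cross (R t i) (R t j) = (if i < s then 1 else t) * (if j < s then 1 else t) * cross (Q i) (Q j)"
      for i j by (simp add: R_def cross_def algebra_simps)
    moreover have "R t i \<noteq> (0, 0)" if "i < r" for i
      using Q(1) \<open>t \<notin> {0}\<close> that by (auto simp: R_def general_position_def prod_eq_iff)
    ultimately have "general_position r (R t)"
      using Q(1) that by (simp add: general_position_def)
    then have "form_rank d (\<Sum>i<r. lin_form (R t i) ^ d) = r"
      by (rule form_rank_general_position[OF _ r d])
    then show ?thesis
      unfolding curve by (intro vanish) (simp add: rank_locus_def forms_sum lin_form_power_in_forms)
  qed
  have "f (form_of d (\<lambda>k. poly (c k) 0)) = 0"
    by (rule polyfun_vanishes_at_limit[where T = "{0}" and c = c, OF f]) (simp, rule generic)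
  moreover have "form_of d (\<lambda>k. poly (c k) 0) = q"
  proof -
    have "(\<Sum>i<r. lin_form (R 0 i) ^ d) = (\<Sum>i<s. lin_form (R 0 i) ^ d)"
      using s d by (intro sum.mono_neutral_right) (auto simp: R_def lin_form_def)
    also have "\<dots> = q" unfolding P(2) by (intro sum.cong) (simp_all add: R_def Q(2))
    finally show ?thesis by (simp add: curve)
  qed
  ultimately show ?thesis by simp
qed

lemma mult_adj_mat_vec:
  fixes A :: "'a::comm_ring_1 mat"
  assumes A: "A \<in> carrier_mat n n" and v: "v \<in> carrier_vec n"
  shows "A *\<^sub>v (adj_mat A *\<^sub>v v) = det A \<cdot>\<^sub>v v"
proof -
  have "A *\<^sub>v (adj_mat A *\<^sub>v v) = (A * adj_mat A) *\<^sub>v v"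
    by (rule assoc_mult_mat_vec[OF A adj_mat(1)[OF A] v, symmetric])
  also have "\<dots> = (det A \<cdot>\<^sub>m 1\<^sub>m n) *\<^sub>v v" by (simp only: adj_mat(2)[OF A])
  also have "\<dots> = det A \<cdot>\<^sub>v v"
  proof (rule eq_vecI)
    fix i assume "i < dim_vec (det A \<cdot>\<^sub>v v)"
    then have i: "i < n" using v by simp
    have "((det A \<cdot>\<^sub>m 1\<^sub>m n) *\<^sub>v v) $ i = row (det A \<cdot>\<^sub>m 1\<^sub>m n) i \<bullet> v"
      using i by simp
    also have "row (det A \<cdot>\<^sub>m 1\<^sub>m n) i = det A \<cdot>\<^sub>v unit_vec n i"
      using i by (intro eq_vecI) auto
    also have "\<dots> \<bullet> v = det A * v $ i" using i v by simp
    finally show "((det A \<cdot>\<^sub>m 1\<^sub>m n) *\<^sub>v v) $ i = (det A \<cdot>\<^sub>v v) $ i" using i v by simp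
  qed (use v in simp)
  finally show ?thesis .
qed

lemma det_map_mat_poly: "det (map_mat (\<lambda>p. poly p t) A) = poly (det A) t"
proof -
  interpret comm_ring_hom "\<lambda>p. poly p t" by unfold_locales simp_all
  show ?thesis by (rule hom_det)
qed

text \<open>
  Let \<open>g\<close> be apolar to \<open>q\<close>, and perturb it to \<open>g + t h\<close>, which has \<open>r\<close> distinct roots for all but
  finitely many \<open>t\<close>. A curve \<open>q\<^sub>t\<close> through \<open>q\<close> such that \<open>g + t h\<close> is apolar to \<open>q\<^sub>t\<close> is found by
  solving a square linear system with Cramer's rule. Its unknowns are the dual coefficients of
  \<open>q\<^sub>t\<close>. Its equations prescribe the pairing of \<open>q\<^sub>t\<close> with \<open>G i + t H i\<close>, where the \<open>G i\<close> form a basis of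
  the polynomials of degree at most \<open>d\<close> that contains all monomial multiples of \<open>g\<close> up to
  formal degree \<open>d\<close>, and where \<open>G i + t H i\<close> are the corresponding multiples of \<open>g + t h\<close>.
  Multiplying by the adjugate matrix instead of the inverse makes the solution polynomial in \<open>t\<close>; it
  multiplies the right-hand side by the determinant, which does no harm where zero
  is prescribed.
\<close>

lemma polyfun_vanishes_on_apolar_locus:
  fixes q :: "'a::{alg_closed_field,field_char_0} poly poly"
  assumes f: "f \<in> form_polyfuns d" and vanish: "\<And>q. power_sum d r q \<Longrightarrow> f q = 0"
    and d: "d \<ge> 1" and r: "1 \<le> r" and q: "q \<in> apolar_locus d r"
  shows "f q = 0"
proof -
  obtain g where g: "g \<noteq> 0" "apolar d q r g" using q by (auto simp: apolar_locus_def)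
  have qf: "q \<in> forms d" using q by (simp add: apolar_locus_def)
  define e where "e = degree g"
  have e: "e \<le> r" using g by (simp add: apolar_def e_def)
  obtain a where a: "poly g a \<noteq> 0"
    using ex_new_if_finite[OF infinite_UNIV_char_0 poly_roots_finite[OF g(1)]] by blast
  \<comment> \<open>a form of full degree without common roots with \<open>g\<close>\<close>
  define h where "h = [:- a, 1:] ^ r"
  have h: "degree h = r" by (simp add: h_def degree_linear_power)
  define bad where "bad = {t. \<not> (degree (g + smult t h) = r \<and> card {x. poly (g + smult t h) x = 0} = r)}"
  have "finite bad"
    unfolding bad_def using e h r a
    by (intro finite_degenerate_pencil_members) (auto simp: e_def h_def poly_power)
  define n where "n = d + 1"
  \<comment> \<open>the degrees \<open>i\<close> for which the basis consists of a monomial multiple of \<open>g\<close>; having one basis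
    element in each degree makes the matrix at \<open>t = 0\<close> lower triangular\<close>
  define mid where "mid i \<longleftrightarrow> e \<le> i \<and> i - e + r \<le> d" for i
  define G where "G i = (if mid i then monom 1 (i - e) * g else monom 1 i)" for i
  define H where "H i = (if mid i then monom 1 (i - e) * h else 0)" for i
  have deg_G: "degree (G i) = i" for i
    using g(1) by (auto simp: G_def mid_def degree_mult_eq degree_monom_eq e_def)
  have G_nz: "G i \<noteq> 0" for i using g(1) by (simp add: G_def)
  define M where "M = mat n n (\<lambda>(i, k). [:coeff (G i) k, coeff (H i) k:])"
  define M0 where "M0 = mat n n (\<lambda>(i, k). coeff (G i) k)"
  have M: "M \<in> carrier_mat n n" and M0: "M0 \<in> carrier_mat n n" by (simp_all add: M_def M0_def)
  have "det M0 = prod_list (diag_mat M0)"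
    by (rule det_lower_triangular[OF _ M0]) (simp add: M0_def coeff_eq_0 deg_G)
  moreover have "coeff (G i) i \<noteq> 0" for i using G_nz[of i] deg_G[of i] by (metis leading_coeff_0_iff)
  ultimately have det_M0: "det M0 \<noteq> 0"
    by (auto simp: prod_list_zero_iff diag_mat_def M0_def)
  define \<delta> where "\<delta> = poly (det M) 0"
  have "map_mat (\<lambda>p. poly p 0) M = M0" by (intro eq_matI) (simp_all add: M_def M0_def)
  then have "\<delta> \<noteq> 0" using det_M0 det_map_mat_poly[of 0 M] by (simp add: \<delta>_def)
  \<comment> \<open>dividing by \<open>\<delta>\<close> normalises the curve to pass through \<open>q\<close> itself at \<open>t = 0\<close>\<close>
  define v where "v = vec n (\<lambda>i. [:pairing d q (G i) / \<delta>:])"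
  have v: "v \<in> carrier_vec n" by (simp add: v_def)
  define b where "b = adj_mat M *\<^sub>v v"
  have b: "b \<in> carrier_vec n" using adj_mat(1)[OF M] v by (simp add: b_def)
  have Mb: "M *\<^sub>v b = det M \<cdot>\<^sub>v v"
    unfolding b_def by (rule mult_adj_mat_vec[OF M v])
  have eq: "(\<Sum>k<n. [:coeff (G i) k, coeff (H i) k:] * b $ k) = det M * [:pairing d q (G i) / \<delta>:]"
    if i: "i < n" for i
  proof -
    have "(\<Sum>k<n. [:coeff (G i) k, coeff (H i) k:] * b $ k) = (\<Sum>k<n. M $$ (i, k) * b $ k)"
      using i by (intro sum.cong refl) (simp only: M_def index_mat lessThan_iff prod.case)
    also have "\<dots> = (M *\<^sub>v b) $ i"
      using i M b by (simp add: scalar_prod_def atLeast0LessThan)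
    also have "\<dots> = det M * v $ i" unfolding Mb using i v by simp
    also have "v $ i = [:pairing d q (G i) / \<delta>:]" using i by (simp add: v_def)
    finally show ?thesis .
  qed
  define Q where "Q t = form_of d (\<lambda>k. poly (b $ k) t)" for t
  have Q: "pairing d (Q t) (G i + smult t (H i)) = poly (det M) t * (pairing d q (G i) / \<delta>)"
    if "i < n" for i t
  proof -
    have "pairing d (Q t) (G i + smult t (H i)) =
        (\<Sum>k<n. (coeff (G i) k + t * coeff (H i) k) * poly (b $ k) t)"
      unfolding pairing_def n_def Q_def
      by (intro sum.cong) (auto simp: dual_coeff_form_of)
    also have "\<dots> = poly (\<Sum>k<n. [:coeff (G i) k, coeff (H i) k:] * b $ k) t"
      by (simp add: poly_sum algebra_simps)
    also have "\<dots> = poly (det M) t * (pairing d q (G i) / \<delta>)"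
      unfolding eq[OF that] by simp
    finally show ?thesis .
  qed
  have generic: "f (form_of d (\<lambda>k. poly (b $ k) t)) = 0" if t: "t \<notin> bad" for t
  proof -
    have gt: "degree (g + smult t h) = r" "card {x. poly (g + smult t h) x = 0} = r"
      using t by (auto simp: bad_def)
    have "apolar d (Q t) r (g + smult t h)"
    proof (rule apolarI_monom)
      show "degree (g + smult t h) \<le> r" using gt by simp
      fix i assume i: "i + r \<le> d"
      then have mid: "mid (i + e)" "i + e < n" using e by (simp_all add: mid_def n_def)
      have "pairing d q (G (i + e)) = 0"
        using g(2) i mid by (simp add: G_def apolar_def degree_monom_eq)
      then have "pairing d (Q t) (G (i + e) + smult t (H (i + e))) = 0" using Q[OF mid(2)] by simp
      then show "pairing d (Q t) (monom 1 i * (g + smult t h)) = 0"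
        using mid by (simp add: G_def H_def distrib_left)
    qed
    then have "power_sum d r (Q t)"
      using gt r by (intro power_sum_of_distinct_roots[OF _ d]) (auto simp: Q_def form_of_in_forms)
    then show ?thesis using vanish by (simp add: Q_def)
  qed
  have "f (Q 0) = 0"
    unfolding Q_def 
    by (rule polyfun_vanishes_at_limit[where T = bad and c = "\<lambda>k. b $ k", OF f \<open>finite bad\<close>])
       (rule generic)
  moreover have "Q 0 = q"
  proof -
    define x where "x = vec n (\<lambda>k. dual_coeff d (Q 0) k - dual_coeff d q k)"
    have "(\<Sum>k<n. coeff (G i) k * (dual_coeff d (Q 0) k - dual_coeff d q k)) = 0" if "i < n" for i
    proof -
      have "pairing d (Q 0) (G i) = pairing d q (G i)"
        using Q[OF that, of 0] \<open>\<delta> \<noteq> 0\<close> by (simp add: \<delta>_def)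
      then show ?thesis
        by (simp add: pairing_def n_def lessThan_Suc_atMost right_diff_distrib sum_subtractf)
    qed
    then have "M0 *\<^sub>v x = 0\<^sub>v n"
      by (intro eq_vecI) (simp_all add: M0_def x_def scalar_prod_def atLeast0LessThan)
    moreover have "x \<in> carrier_vec n" by (simp add: x_def)
    ultimately have "x = 0\<^sub>v n" using det_M0 det_0_iff_vec_prod_zero_field[OF M0] by blast
    have "dual_coeff d (Q 0) k = dual_coeff d q k" if "k \<le> d" for k
    proof -
      have "k < n" using that by (simp add: n_def)
      then have "x $ k = 0" using \<open>x = 0\<^sub>v n\<close> by simp
      then show ?thesis using \<open>k < n\<close> by (simp add: x_def)
    qed
    then show ?thesis by (intro forms_eqI[OF _ qf]) (simp_all add: Q_def form_of_in_forms)
  qed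
  ultimately show ?thesis by simp
qed

section \<open>The closures of the rank loci\<close>

lemma rank_locus_subset_apolar_locus:
  assumes "d \<ge> 1"
  shows "rank_locus d r \<subseteq> (apolar_locus d r :: 'a::{alg_closed_field,field_char_0} poly poly set)"
proof
  fix q :: "'a poly poly" assume q: "q \<in> rank_locus d r"
  then obtain r' where "power_sum d r' q"
    using power_sum_exists[of q d] assms by (auto simp: rank_locus_def)
  from form_rank_properties(2)[OF this assms] have "power_sum d r q" using q by (simp add: rank_locus_def)
  then show "q \<in> apolar_locus d r" by (rule power_sum_in_apolar_locus)
qed

text \<open>
  The bound on \<open>r\<close> guarantees that rank \<open>r\<close> is generic among sums of \<open>r\<close> powers.
\<close>

lemma closure_rank_locus:
  assumes d: "d \<ge> 1" and r: "1 \<le> r" "2 * r \<le> d + 2"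
  shows "zariski_closure d (rank_locus d r)
    = (apolar_locus d r :: 'a::{alg_closed_field,field_char_0} poly poly set)"
  unfolding zariski_closure_def
proof (rule hull_unique)
  show "rank_locus d r \<subseteq> (apolar_locus d r :: 'a poly poly set)"
    by (rule rank_locus_subset_apolar_locus[OF d])
  show "zariski_closed d (apolar_locus d r :: 'a poly poly set)" by (rule apolar_locus_closed)
  fix Z :: "'a poly poly set" assume Z: "rank_locus d r \<subseteq> Z" "zariski_closed d Z"
  then obtain F where F: "F \<subseteq> form_polyfuns d" "Z = {q \<in> forms d. \<forall>f\<in>F. f q = 0}"
    by (auto simp: zariski_closed_def)
  show "apolar_locus d r \<subseteq> Z"
  proof
    fix q :: "'a poly poly" assume q: "q \<in> apolar_locus d r"
    have "f q = 0" if "f \<in> F" for f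
    proof -
      have f: "f \<in> form_polyfuns d" using F that by blast
      have rank: "f p = 0" if "p \<in> rank_locus d r" for p
        using Z(1) F(2) \<open>f \<in> F\<close> that by blast
      have "f p = 0" if "power_sum d r p" for p
        by (rule polyfun_vanishes_on_power_sums[OF f rank d r that])
      then show ?thesis by (rule polyfun_vanishes_on_apolar_locus[OF f _ d r(1) q])
    qed
    then show "q \<in> Z" using q F(2) by (simp add: apolar_locus_def)
  qed
qed

lemma closure_rank_locus_0:
  assumes "d \<ge> 1"
  shows "zariski_closure d (rank_locus d 0 :: 'a::{alg_closed_field,field_char_0} poly poly set) = {}"
proof -
  have "rank_locus d 0 = ({} :: 'a poly poly set)"
    using power_sum_exists form_rank_properties(1) assms by (fastforce simp: rank_locus_def)
  moreover have "zariski_closed d ({} :: 'a poly poly set)"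
    unfolding zariski_closed_def
    by (rule exI[of _ "{\<lambda>_. 1}"]) (auto intro: form_polyfuns.const)
  ultimately show ?thesis by (simp add: zariski_closure_def hull_same)
qed

section \<open>Secant planes of the Veronese curve\<close>

lemma exists_separating_pairing:
  fixes P :: "nat \<Rightarrow> 'a::field_char_0 \<times> 'a"
  assumes "general_position s P" "s \<le> d + 1" "j < s"
  obtains h where "pairing d (lin_form (P j) ^ d) h \<noteq> 0"
    "\<And>i. i < s \<Longrightarrow> i \<noteq> j \<Longrightarrow> pairing d (lin_form (P i) ^ d) h = 0"
  using exists_separating_polynomial[OF assms(1,3,2)] by (auto simp: pairing_lin_form_power)

lemma powers_not_proportional:
  fixes P :: "nat \<Rightarrow> 'a::field_char_0 \<times> 'a"
  assumes "general_position s P" "s \<le> d + 1" "i < s" "j < s"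
    and "lin_form (P i) ^ d = scale_form c (lin_form (P j) ^ d)"
  shows "i = j"
proof (rule ccontr)
  assume "i \<noteq> j"
  obtain h where h: "pairing d (lin_form (P i) ^ d) h \<noteq> 0"
    "\<And>l. l < s \<Longrightarrow> l \<noteq> i \<Longrightarrow> pairing d (lin_form (P l) ^ d) h = 0"
    using exists_separating_pairing[OF assms(1-3)] by blast
  have "pairing d (lin_form (P i) ^ d) h = c * pairing d (lin_form (P j) ^ d) h"
    unfolding assms(5) by (rule pairing_scale_left)
  also have "\<dots> = 0" using h(2)[OF assms(4)] \<open>i \<noteq> j\<close> by simp
  finally show False using h(1) by contradiction
qed

lemma powers_inj:
  fixes P :: "nat \<Rightarrow> 'a::field_char_0 \<times> 'a"
  assumes "general_position s P" "s \<le> d + 1"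
  shows "inj_on (\<lambda>i. lin_form (P i) ^ d) {..<s}"
proof (rule inj_onI)
  fix i j assume "i \<in> {..<s}" "j \<in> {..<s}" "lin_form (P i) ^ d = lin_form (P j) ^ d"
  then show "i = j" using powers_not_proportional[OF assms, of i j 1] by simp
qed

text \<open>
  Distinct points of a rational normal curve of degree \<open>d\<close> are independent as long as there are at
  most \<open>d + 1\<close> of them.
\<close>

lemma powers_independent:
  fixes P :: "nat \<Rightarrow> 'a::field_char_0 \<times> 'a"
  assumes "general_position s P" "s \<le> d + 1"
  shows "form.independent ((\<lambda>i. lin_form (P i) ^ d) ` {..<s})"
proof (rule form.independent_if_scalars_zero)
  show "finite ((\<lambda>i. lin_form (P i) ^ d) ` {..<s})" by simp
  fix f x
  assume zero: "(\<Sum>x\<in>(\<lambda>i. lin_form (P i) ^ d) ` {..<s}. scale_form (f x) x) = 0"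
    and "x \<in> (\<lambda>i. lin_form (P i) ^ d) ` {..<s}"
  then obtain j where j: "j < s" "x = lin_form (P j) ^ d" by blast
  obtain h where h: "pairing d (lin_form (P j) ^ d) h \<noteq> 0"
    "\<And>i. i < s \<Longrightarrow> i \<noteq> j \<Longrightarrow> pairing d (lin_form (P i) ^ d) h = 0"
    using exists_separating_pairing[OF assms j(1)] by blast
  have "(\<Sum>i<s. scale_form (f (lin_form (P i) ^ d)) (lin_form (P i) ^ d)) = 0"
    using zero by (simp add: sum.reindex[OF powers_inj[OF assms]])
  then have "0 = pairing d (\<Sum>i<s. scale_form (f (lin_form (P i) ^ d)) (lin_form (P i) ^ d)) h" by simp
  also have "\<dots> = (\<Sum>i<s. f (lin_form (P i) ^ d) * pairing d (lin_form (P i) ^ d) h)"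
    by (simp only: pairing_sum_left pairing_scale_left)
  also have "\<dots> = (\<Sum>i<s. if i = j then f x * pairing d x h else 0)"
    using h(2) j by (intro sum.cong) auto
  also have "\<dots> = f x * pairing d x h" using j(1) by simp
  finally show "f x = 0" using h(1) j(2) by simp
qed

lemma proj_point_self: "q \<in> proj_point q"
  by (auto simp: proj_point_def intro!: exI[of _ 1])

lemma Union_proj_points_subset_span: "(\<Union>i\<in>I. proj_point (v i)) \<subseteq> form.span (v ` I)"
  by (auto simp: proj_point_def intro!: form.span_scale intro: form.span_base)

lemma power_sum_if_on_secant:
  fixes q :: "'a::alg_closed_field poly poly"
  assumes d: "d \<ge> 1" and P: "P \<subseteq> veronese_curve d" "card P = k + 1" and q: "proj_point q \<in> proj_span P"
  shows "power_sum d (k + 1) q"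
proof -
  obtain w where w: "w \<in> form.span (\<Union>P)" "proj_point q = proj_point w"
    using q by (auto simp: proj_span_def proj_space_def)
  then have "q \<in> proj_point w" using proj_point_self by blast
  then have q_span: "q \<in> form.span (\<Union>P)"
    using w(1) by (auto simp: proj_point_def intro: form.span_scale)
  have "\<exists>R. p = proj_point (lin_form R ^ d)" if "p \<in> P" for p
  proof -
    have "p \<in> veronese_curve d" using that P(1) by blast
    then obtain L where "L \<in> forms 1" "p = proj_point (L ^ d)" unfolding veronese_curve_def by blast
    then show ?thesis using forms_1_cases by metis
  qed
  then obtain R where R: "\<And>p. p \<in> P \<Longrightarrow> p = proj_point (lin_form (R p) ^ d)" by metis
  define B where "B = (\<lambda>p. lin_form (R p) ^ d) ` P"
  have "\<Union>P = (\<Union>p\<in>P. proj_point (lin_form (R p) ^ d))" using R by auto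
  then have "\<Union>P \<subseteq> form.span B"
    unfolding B_def using Union_proj_points_subset_span[of "\<lambda>p. lin_form (R p) ^ d" P] by simp
  then have "q \<in> form.span B"
    using q_span form.span_minimal[OF _ form.subspace_span] by blast
  moreover have fin: "finite P" using P(2) by (simp add: card_ge_0_finite)
  then have "finite B" by (simp add: B_def)
  ultimately obtain u where u: "q = (\<Sum>v\<in>B. scale_form (u v) v)"
    by (auto simp: form.span_finite)
  have "\<forall>v\<in>B. \<exists>S. v = lin_form S ^ d" unfolding B_def by blast
  then obtain S where "\<And>v. v \<in> B \<Longrightarrow> v = lin_form (S v) ^ d" by metis
  then have "q = (\<Sum>v\<in>B. scale_form (u v) (lin_form (S v) ^ d))"
    unfolding u by (intro sum.cong) auto
  moreover have "card B \<le> k + 1" using card_image_le[OF fin] P(2) by (simp add: B_def)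
  ultimately show ?thesis using power_sumI[OF d \<open>finite B\<close>] by blast
qed

lemma on_secant_if_general_position:
  fixes P :: "nat \<Rightarrow> 'a::field_char_0 \<times> 'a"
  assumes gp: "general_position (k + 1) P" and "k \<le> d"
    and q: "q = (\<Sum>i<k + 1. lin_form (P i) ^ d)" "q \<noteq> 0"
  shows "\<exists>\<Lambda>. secant_plane d k \<Lambda> \<and> proj_point q \<in> \<Lambda>"
proof -
  define v where "v i = lin_form (P i) ^ d" for i
  define Q where "Q = (\<lambda>i. proj_point (v i)) ` {..<k + 1}"
  define W where "W = form.span (\<Union>Q)"
  have le: "k + 1 \<le> d + 1" using assms(2) by simp
  have "lin_form (P i) \<noteq> 0" if "i < k + 1" for i
    using gp that by (auto simp: general_position_def lin_form_def prod_eq_iff)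
  then have "proj_point (v i) \<in> veronese_curve d" if "i < k + 1" for i
    using that lin_form_in_forms[of "P i"] unfolding veronese_curve_def v_def by blast
  then have "Q \<subseteq> veronese_curve d" unfolding Q_def by blast
  moreover have "card Q = k + 1"
  proof -
    have "inj_on (\<lambda>i. proj_point (v i)) {..<k + 1}"
    proof (rule inj_onI)
      fix i j assume ij: "i \<in> {..<k + 1}" "j \<in> {..<k + 1}" "proj_point (v i) = proj_point (v j)"
      then have "v i \<in> proj_point (v j)" using proj_point_self by blast
      then obtain c where "v i = scale_form c (v j)" by (auto simp: proj_point_def)
      then show "i = j" using powers_not_proportional[OF gp le] ij by (auto simp: v_def)
    qed
    then show ?thesis by (simp add: Q_def card_image)
  qed
  moreover have W_eq: "W = form.span (v ` {..<k + 1})"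
    unfolding W_def
  proof (rule form.span_eq[THEN iffD2], rule conjI)
    show "\<Union>Q \<subseteq> form.span (v ` {..<k + 1})"
      unfolding Q_def by (rule Union_proj_points_subset_span)
    have "v ` {..<k + 1} \<subseteq> \<Union>Q" using proj_point_self by (auto simp: Q_def)
    then show "v ` {..<k + 1} \<subseteq> form.span (\<Union>Q)" using form.span_superset by blast
  qed
  have "proj_plane d k (proj_span Q)"
    unfolding proj_plane_def
  proof (intro exI[of _ W] conjI)
    show "form.subspace W" by (simp add: W_def)
    show "proj_span Q = proj_space W" by (simp add: proj_span_def W_def)
    have "form.subspace (forms d)" by (intro form.subspaceI forms_0 forms_add forms_scale)
    then show "W \<subseteq> forms d"
      unfolding W_eq by (intro form.span_minimal) (auto simp: v_def lin_form_power_in_forms)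
    have "form.dim W = card (v ` {..<k + 1})"
      unfolding W_eq v_def by (rule form.dim_span_eq_card_independent[OF powers_independent[OF gp le]])
    then show "form.dim W = k + 1"
      using powers_inj[OF gp le] by (simp add: v_def card_image)
  qed
  moreover have "q \<in> W"
    unfolding q(1) W_eq v_def by (intro form.span_sum form.span_base) auto
  then have "proj_point q \<in> proj_span Q"
    using q(2) by (auto simp: proj_span_def proj_space_def W_def)
  ultimately show ?thesis unfolding secant_plane_def by blast
qed

section \<open>Stratification of the space of forms by rank\<close>

text \<open>
  Representations have at least one summand. Hence the zero form belongs to the stratum \<open>k = 0\<close>,
  although it has an apolar form of degree \<open>0\<close>.
\<close>

lemma form_rank_0:
  assumes "d \<ge> 1"
  shows "form_rank d (0 :: 'a::alg_closed_field poly poly) = 1"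
proof -
  have "power_sum d 1 (0 :: 'a poly poly)"
    using power_sum_mono[of d 0 0 1] assms by (simp add: power_sum_def)
  then show ?thesis using form_rank_properties(1) form_rank_le assms by (metis le_antisym le_refl)
qed

text \<open>
  The two possible ranks determine the least apolar degree because it is at most
  \<open>d div 2 + 1\<close>.
\<close>

lemma form_rank_in_stratum_iff:
  fixes q :: "'a::{alg_closed_field,field_char_0} poly poly"
  assumes d: "d \<ge> 1" and k: "k \<le> d div 2" and q: "q \<in> forms d" "q \<noteq> 0"
  shows "q \<in> apolar_locus d (k + 1) - apolar_locus d k
    \<longleftrightarrow> form_rank d q = k + 1 \<or> form_rank d q = d - k + 1"
proof
  assume "q \<in> apolar_locus d (k + 1) - apolar_locus d k"
  moreover have "d + 2 - (k + 1) = d - k + 1" "k \<le> d" using k by linarith+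
  ultimately show "form_rank d q = k + 1 \<or> form_rank d q = d - k + 1"
    using sylvester_rank[of d "k + 1" q] d by auto
next
  assume rank: "form_rank d q = k + 1 \<or> form_rank d q = d - k + 1"
  obtain r where r: "1 \<le> r" "r \<le> d div 2 + 1" "q \<in> apolar_locus d r" "q \<notin> apolar_locus d (r - 1)"
    using apolar_degree_exists[OF q] by blast
  then have "form_rank d q = r \<or> form_rank d q = d + 2 - r"
    using d by (intro sylvester_rank) auto
  then have "r = k + 1" using rank r(1,2) k by linarith
  then show "q \<in> apolar_locus d (k + 1) - apolar_locus d k" using r(3,4) by simp
qed

theorem theorem2:
  fixes d k :: nat
  assumes "d \<ge> 1" and "k \<le> d div 2"
  shows "zariski_closure d (rank_locus d 0 :: 'a::{alg_closed_field, field_char_0} poly poly set) = {} \<and>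
    zariski_closure d (rank_locus d (k + 1)) - zariski_closure d (rank_locus d k)
      = (rank_locus d (k + 1) \<union> rank_locus d (d - k + 1) :: 'a poly poly set) \<and>
    (\<forall>q :: 'a poly poly.
       q \<in> zariski_closure d (rank_locus d (k + 1)) - zariski_closure d (rank_locus d k) \<and> q \<noteq> 0 \<longrightarrow>
         (form_rank d q = k + 1 \<longleftrightarrow> (\<exists>\<Lambda>. secant_plane d k \<Lambda> \<and> proj_point q \<in> \<Lambda>)) \<and>
         (\<not> (\<exists>\<Lambda>. secant_plane d k \<Lambda> \<and> proj_point q \<in> \<Lambda>) \<longrightarrow> form_rank d q = d - k + 1))"
proof -
  let ?C = "\<lambda>r. zariski_closure d (rank_locus d r) :: 'a poly poly set"
  have C: "?C r = apolar_locus d r" if "1 \<le> r" "r \<le> k + 1" for r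
    using that assms by (intro closure_rank_locus) auto
  have stratum_nonzero: "q \<in> ?C (k + 1) - ?C k \<longleftrightarrow> q \<in> apolar_locus d (k + 1) - apolar_locus d k"
    if "q \<noteq> 0" for q :: "'a poly poly"
  proof (cases "k = 0")
    case True
    then show ?thesis
      using C[of 1] closure_rank_locus_0[OF assms(1), where 'a = 'a] apolar_locus_0[of q d] that by auto
  next
    case False
    then show ?thesis using C[of k] C[of "k + 1"] by simp
  qed
  have stratum_zero: "0 \<in> ?C (k + 1) - ?C k \<longleftrightarrow> k = 0"
    using C[of k] C[of "k + 1"] closure_rank_locus_0[OF assms(1), where 'a = 'a]
      zero_in_apolar_locus[of d, where 'a = 'a] by (cases "k = 0") auto
  have forms: "?C (k + 1) \<subseteq> forms d" using C[of "k + 1"] by (auto simp: apolar_locus_def)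
  have stratum: "?C (k + 1) - ?C k = rank_locus d (k + 1) \<union> rank_locus d (d - k + 1)"
  proof (rule Set.set_eqI)
    fix q :: "'a poly poly"
    show "q \<in> ?C (k + 1) - ?C k \<longleftrightarrow> q \<in> rank_locus d (k + 1) \<union> rank_locus d (d - k + 1)"
    proof (cases "q = 0")
      case True
      have "q \<in> rank_locus d (k + 1) \<union> rank_locus d (d - k + 1) \<longleftrightarrow> k = 0"
        using True assms by (auto simp: rank_locus_def form_rank_0 forms_0)
      then show ?thesis using True stratum_zero by simp
    next
      case False
      show ?thesis
      proof (cases "q \<in> forms d")
        case True
        then show ?thesis
          unfolding stratum_nonzero[OF False] form_rank_in_stratum_iff[OF assms True False]
          by (auto simp: rank_locus_def)
      next
        case False
        then show ?thesis using forms by (auto simp: rank_locus_def)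
      qed
    qed
  qed
  have secant: "form_rank d q = k + 1 \<longleftrightarrow> (\<exists>\<Lambda>. secant_plane d k \<Lambda> \<and> proj_point q \<in> \<Lambda>)"
    if q: "q \<in> ?C (k + 1) - ?C k" "q \<noteq> 0" for q :: "'a poly poly"
  proof
    assume rank: "form_rank d q = k + 1"
    have "q \<in> forms d" using q(1) forms by blast
    then obtain r where "power_sum d r q" using power_sum_exists[OF _ assms(1)] by blast
    from form_rank_properties(2)[OF this assms(1)] have "power_sum d (k + 1) q" by (simp add: rank)
    then obtain s P where s: "s \<le> k + 1" "general_position s P" "q = (\<Sum>i<s. lin_form (P i) ^ d)"
      using power_sum_general_position[OF _ assms(1)] by blast
    have "1 \<le> s" using s(3) q(2) by (cases s) auto
    moreover have "power_sum d s q" using s(3) by (auto simp: power_sum_def)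
    ultimately have "k + 1 \<le> s" using form_rank_le rank by metis
    then have "s = k + 1" using s(1) by simp
    then show "\<exists>\<Lambda>. secant_plane d k \<Lambda> \<and> proj_point q \<in> \<Lambda>"
      using s(2,3) q(2) assms(2) by (intro on_secant_if_general_position) auto
  next
    assume "\<exists>\<Lambda>. secant_plane d k \<Lambda> \<and> proj_point q \<in> \<Lambda>"
    then obtain P where "P \<subseteq> veronese_curve d" "card P = k + 1" "proj_point q \<in> proj_span P"
      by (auto simp: secant_plane_def)
    then have "form_rank d q \<le> k + 1"
      using power_sum_if_on_secant[OF assms(1)] by (intro form_rank_le) auto
    moreover have "form_rank d q = k + 1 \<or> form_rank d q = d - k + 1"
      using q(1) unfolding stratum by (auto simp: rank_locus_def)
    ultimately show "form_rank d q = k + 1" using assms(2) by linarith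
  qed
  have "form_rank d q = k + 1 \<or> form_rank d q = d - k + 1" if "q \<in> ?C (k + 1) - ?C k"
    for q :: "'a poly poly"
    using that unfolding stratum by (auto simp: rank_locus_def)
  then show ?thesis
    using closure_rank_locus_0[OF assms(1)] stratum secant by blast
qed

end
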